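(* Let $(\Omega,\Sigma,\mu)$ be a finite measure space which is not purely atomic and let $Y$ be a Banach space. If $\operatorname{RSE}(L_1(\mu),Y)$ is dense in $\mathcal{L}(L_1(\mu),Y)$, then $Y$ has the Radon--Nikod\'ym property.
   Context: Banach spaces are over $\mathbb{K}$, where $\mathbb{K}=\mathbb{R}$ or $\mathbb{C}$. $\mathbb{T}=\{\theta\in\mathbb{K}\colon |\theta|=1\}$; $B_X$, $S_X$ are the closed unit ball and unit sphere of $X$; $\mathcal{L}(X,Y)$ is the space of bounded linear operators with the operator norm, and density is with respect to this norm. $T\in\operatorname{RSE}(X,Y)$ (range strongly exposing) means: there exists $x_0\in S_X$ such that whenever $(x_n)\subseteq B_X$ satisfies $\|Tx_n\|\to\|T\|$, there are a subsequence $(x_{\sigma(n)})$ and $\theta\in\mathbb{T}$ with $Tx_{\sigma(n)}\to\theta Tx_0$ in norm. $Y$ has the Radon--Nikod\'ym property if for every finite measure space $(\Omega',\Sigma',\nu)$, each $\nu$-continuous vector measure $G\colon\Sigma'\to Y$ of bounded variation has a Bochner integrable Radon--Nikod\'ym derivative with respect to $\nu$. A finite measure is purely atomic if every measurable set of positive measure contains an atom. *)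

theory Defs
  imports "HOL-Analysis.Analysis"
begin

text \<open>
  The scalar field is a type variable of class \<open>real_normed_field\<close>, used only at the types
  \<^typ>\<open>real\<close> and \<^typ>\<open>complex\<close>.  The domain of an operator is a normed space with an explicit
  carrier, since \<open>L\<^sub>1(\<mu>)\<close> depends on a measure and so is not a type.
\<close>

record ('k, 'x) normed_structure =
  nspace :: "'x set"
  nadd :: "'x \<Rightarrow> 'x \<Rightarrow> 'x"
  nscale :: "'k \<Rightarrow> 'x \<Rightarrow> 'x"
  nnorm :: "'x \<Rightarrow> real"

definition unit_ball :: "('k, 'x) normed_structure \<Rightarrow> 'x set" where
  "unit_ball X = {x \<in> nspace X. nnorm X x \<le> 1}"

definition unit_sphere :: "('k, 'x) normed_structure \<Rightarrow> 'x set" where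
  "unit_sphere X = {x \<in> nspace X. nnorm X x = 1}"

text \<open>
  A Banach space over \<open>'k\<close>: the class \<open>banach\<close> provides the norm, its completeness and the
  multiplication by real scalars; \<open>sc\<close> is the multiplication by scalars in \<open>'k\<close>, which extends
  it.  For \<open>'k = real\<close> the only possibility is \<open>sc = scaleR\<close>.
\<close>

definition banach_over :: "('k::real_normed_field \<Rightarrow> 'y \<Rightarrow> 'y::banach) \<Rightarrow> bool" where
  "banach_over sc \<longleftrightarrow> vector_space sc
     \<and> (\<forall>r y. sc (of_real r) y = r *\<^sub>R y)
     \<and> (\<forall>c y. norm (sc c y) = norm c * norm y)"

subsection \<open>The Banach space \<open>L\<^sub>1(\<mu>)\<close>\<close>

text \<open>Its elements are the classes of integrable functions modulo equality almost everywhere.\<close>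

definition ae_eq ::
  "'a measure \<Rightarrow> (('a \<Rightarrow> 'k::{banach,second_countable_topology}) \<times> ('a \<Rightarrow> 'k)) set" where
  "ae_eq M = {(f, g). integrable M f \<and> integrable M g \<and> (AE x in M. f x = g x)}"

definition ae_class ::
  "'a measure \<Rightarrow> ('a \<Rightarrow> 'k::{banach,second_countable_topology}) \<Rightarrow> ('a \<Rightarrow> 'k) set" where
  "ae_class M f = ae_eq M `` {f}"

definition ae_rep :: "('a \<Rightarrow> 'k) set \<Rightarrow> 'a \<Rightarrow> 'k" where
  "ae_rep A = (SOME f. f \<in> A)"

definition L1 ::
  "'a measure \<Rightarrow>
    ('k::{real_normed_field,banach,second_countable_topology}, ('a \<Rightarrow> 'k) set) normed_structure"
  where
  "L1 M = \<lparr>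
     nspace = {f. integrable M f} // ae_eq M,
     nadd = (\<lambda>A B. ae_class M (\<lambda>x. ae_rep A x + ae_rep B x)),
     nscale = (\<lambda>c A. ae_class M (\<lambda>x. c * ae_rep A x)),
     nnorm = (\<lambda>A. \<integral>x. norm (ae_rep A x) \<partial>M) \<rparr>"

lemma equiv_ae_eq: "equiv {f. integrable M f} (ae_eq M)"
proof (rule equivI)
  show "ae_eq M \<subseteq> {f. integrable M f} \<times> {f. integrable M f}" "refl_on {f. integrable M f} (ae_eq M)"
    by (auto simp: ae_eq_def refl_on_def)
  show "sym (ae_eq M)"
    by (auto simp: ae_eq_def sym_def eq_commute)
  show "trans (ae_eq M)"
  proof (rule transI)
    fix f g h assume "(f, g) \<in> ae_eq M" "(g, h) \<in> ae_eq M"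
    then have "integrable M f" "integrable M h" "AE x in M. f x = g x" "AE x in M. g x = h x"
      by (auto simp: ae_eq_def)
    moreover from this(3,4) have "AE x in M. f x = h x" by eventually_elim simp
    ultimately show "(f, h) \<in> ae_eq M" by (simp add: ae_eq_def)
  qed
qed

lemma ae_rep_ae_class:
  assumes "integrable M f"
  shows "integrable M (ae_rep (ae_class M f))" "AE x in M. ae_rep (ae_class M f) x = f x"
proof -
  have "f \<in> ae_class M f" using assms by (simp add: ae_class_def ae_eq_def)
  then have "ae_rep (ae_class M f) \<in> ae_class M f"
    unfolding ae_rep_def by (rule someI[where P = "\<lambda>g. g \<in> ae_class M f"])
  then show "integrable M (ae_rep (ae_class M f))" "AE x in M. ae_rep (ae_class M f) x = f x"
    by (auto simp: ae_class_def ae_eq_def eq_commute)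
qed

lemma ae_class_eqI:
  assumes "integrable M f" "integrable M g" "AE x in M. f x = g x"
  shows "ae_class M f = ae_class M g"
  unfolding ae_class_def
  by (rule equiv_class_eq[OF equiv_ae_eq]) (use assms in \<open>simp add: ae_eq_def\<close>)

lemma nspace_L1: "nspace (L1 M) = ae_class M ` {f. integrable M f}"
  by (auto simp: L1_def quotient_def ae_class_def)

lemma nadd_L1:
  assumes "integrable M f" "integrable M g"
  shows "nadd (L1 M) (ae_class M f) (ae_class M g) = ae_class M (\<lambda>x. f x + g x)"
proof -
  have "AE x in M. ae_rep (ae_class M f) x + ae_rep (ae_class M g) x = f x + g x"
    using ae_rep_ae_class(2)[OF assms(1)] ae_rep_ae_class(2)[OF assms(2)]
    by eventually_elim simp
  then show ?thesis
    using assms ae_rep_ae_class(1)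
    unfolding L1_def normed_structure.simps
    by (intro ae_class_eqI Bochner_Integration.integrable_add integrable_mult_right)
qed

lemma nscale_L1:
  assumes "integrable M f"
  shows "nscale (L1 M) c (ae_class M f) = ae_class M (\<lambda>x. c * f x)"
proof -
  have "AE x in M. c * ae_rep (ae_class M f) x = c * f x"
    using ae_rep_ae_class(2)[OF assms] by eventually_elim simp
  then show ?thesis
    using assms ae_rep_ae_class(1)
    unfolding L1_def normed_structure.simps
    by (intro ae_class_eqI Bochner_Integration.integrable_add integrable_mult_right)
qed

lemma nnorm_L1:
  assumes "integrable M f"
  shows "nnorm (L1 M) (ae_class M f) = (\<integral>x. norm (f x) \<partial>M)"
  using ae_rep_ae_class[OF assms] assms
  by (auto simp: L1_def intro!: integral_cong_AE)

subsection \<open>Operators\<close>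

text \<open>
  An operator is a function on the type underlying the carrier; its values outside the carrier
  are irrelevant and enter neither the operator norm nor \<open>RSE\<close>.
\<close>

definition bounded_operators ::
  "('k, 'x) normed_structure \<Rightarrow> ('k \<Rightarrow> 'y \<Rightarrow> 'y) \<Rightarrow> ('x \<Rightarrow> 'y::real_normed_vector) set" where
  "bounded_operators X sc = {T.
     (\<forall>x\<in>nspace X. \<forall>y\<in>nspace X. T (nadd X x y) = T x + T y) \<and>
     (\<forall>c. \<forall>x\<in>nspace X. T (nscale X c x) = sc c (T x)) \<and>
     (\<exists>C. \<forall>x\<in>nspace X. norm (T x) \<le> C * nnorm X x)}"

definition op_norm :: "('k, 'x) normed_structure \<Rightarrow> ('x \<Rightarrow> 'y::real_normed_vector) \<Rightarrow> real" where
  "op_norm X T = (SUP x\<in>unit_ball X. norm (T x))"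

definition RSE ::
  "('k::real_normed_field, 'x) normed_structure \<Rightarrow> ('k \<Rightarrow> 'y \<Rightarrow> 'y) \<Rightarrow>
    ('x \<Rightarrow> 'y::real_normed_vector) set" where
  "RSE X sc = {T \<in> bounded_operators X sc.
     \<exists>x0\<in>unit_sphere X. \<forall>x. range x \<subseteq> unit_ball X \<longrightarrow>
       (\<lambda>n. norm (T (x n))) \<longlonglongrightarrow> op_norm X T \<longrightarrow>
       (\<exists>\<sigma> \<theta>. strict_mono (\<sigma> :: nat \<Rightarrow> nat) \<and> norm \<theta> = 1 \<and>
          (\<lambda>n. T (x (\<sigma> n))) \<longlonglongrightarrow> sc \<theta> (T x0))}"

definition op_dense ::
  "('k, 'x) normed_structure \<Rightarrow> ('x \<Rightarrow> 'y::real_normed_vector) set \<Rightarrow> ('x \<Rightarrow> 'y) set \<Rightarrow> bool" where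
  "op_dense X D L \<longleftrightarrow> (\<forall>T\<in>L. \<forall>\<epsilon>>0. \<exists>S\<in>D. op_norm X (\<lambda>x. S x - T x) < \<epsilon>)"

subsection \<open>The Radon--Nikodym property\<close>

text \<open>
  The library's Bochner integral requires a second countable target, which would restrict it to
  separable Banach spaces.  The following is the textbook definition for finite measures and
  arbitrary Banach spaces, built on the library's simple functions and their integrals.
\<close>

definition strongly_measurable :: "'w measure \<Rightarrow> ('w \<Rightarrow> 'y::banach) \<Rightarrow> bool" where
  "strongly_measurable N g \<longleftrightarrow>
     (\<exists>s. (\<forall>i. simple_function N (s i)) \<and> (AE x in N. (\<lambda>i. s i x) \<longlonglongrightarrow> g x))"

definition has_bochner :: "'w measure \<Rightarrow> ('w \<Rightarrow> 'y::banach) \<Rightarrow> 'y \<Rightarrow> bool" where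
  "has_bochner N g y \<longleftrightarrow> strongly_measurable N g \<and>
     (\<exists>s. (\<forall>i. Bochner_Integration.simple_bochner_integrable N (s i)) \<and>
          (\<lambda>i. \<integral>\<^sup>+x. ennreal (norm (g x - s i x)) \<partial>N) \<longlonglongrightarrow> 0 \<and>
          (\<lambda>i. Bochner_Integration.simple_bochner_integral N (s i)) \<longlonglongrightarrow> y)"

definition bochner_integrable :: "'w measure \<Rightarrow> ('w \<Rightarrow> 'y::banach) \<Rightarrow> bool" where
  "bochner_integrable N g \<longleftrightarrow> (\<exists>y. has_bochner N g y)"

definition vector_measure :: "'w measure \<Rightarrow> ('w set \<Rightarrow> 'y::banach) \<Rightarrow> bool" where
  "vector_measure N G \<longleftrightarrow>
     (\<forall>A :: nat \<Rightarrow> 'w set. range A \<subseteq> sets N \<longrightarrow> disjoint_family A \<longrightarrow>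
        (\<lambda>i. G (A i)) sums G (\<Union>i. A i))"

definition bounded_variation :: "'w measure \<Rightarrow> ('w set \<Rightarrow> 'y::banach) \<Rightarrow> bool" where
  "bounded_variation N G \<longleftrightarrow>
     (\<exists>C. \<forall>P. finite P \<longrightarrow> P \<subseteq> sets N \<longrightarrow> partition_on (space N) P \<longrightarrow>
        (\<Sum>A\<in>P. norm (G A)) \<le> C)"

text \<open>\<open>N\<close>-continuity means \<open>G(E) \<rightarrow> 0\<close> as \<open>N(E) \<rightarrow> 0\<close>.\<close>

definition measure_continuous :: "'w measure \<Rightarrow> ('w set \<Rightarrow> 'y::banach) \<Rightarrow> bool" where
  "measure_continuous N G \<longleftrightarrow>
     (\<forall>\<epsilon>>0. \<exists>\<delta>>0. \<forall>E\<in>sets N. measure N E < \<delta> \<longrightarrow> norm (G E) < \<epsilon>)"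

text \<open>
  HOL cannot quantify over types inside a formula, so the type \<open>'w\<close> of the points of the
  auxiliary measure spaces is a parameter.  A theorem with conclusion
  \<open>radon_nikodym_property TYPE('w) TYPE('y)\<close> and an otherwise unconstrained \<open>'w\<close> covers the
  measure spaces over all types.
\<close>

definition radon_nikodym_property :: "'w itself \<Rightarrow> 'y::banach itself \<Rightarrow> bool" where
  "radon_nikodym_property _ _ \<longleftrightarrow>
     (\<forall>(N :: 'w measure) (G :: 'w set \<Rightarrow> 'y).
        finite_measure N \<longrightarrow> vector_measure N G \<longrightarrow> measure_continuous N G \<longrightarrow>
        bounded_variation N G \<longrightarrow>
        (\<exists>g. bochner_integrable N g \<and>
             (\<forall>E\<in>sets N. has_bochner N (\<lambda>x. indicator E x *\<^sub>R g x) (G E))))"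

subsection \<open>Atoms\<close>

definition is_atom :: "'a measure \<Rightarrow> 'a set \<Rightarrow> bool" where
  "is_atom M A \<longleftrightarrow> A \<in> sets M \<and> emeasure M A > 0 \<and>
     (\<forall>B\<in>sets M. B \<subseteq> A \<longrightarrow> emeasure M B = 0 \<or> emeasure M (A - B) = 0)"

definition purely_atomic :: "'a measure \<Rightarrow> bool" where
  "purely_atomic M \<longleftrightarrow>
     (\<forall>E\<in>sets M. emeasure M E > 0 \<longrightarrow> (\<exists>A. A \<subseteq> E \<and> is_atom M A))"

end

theory Submission
  imports Defs
begin

text \<open>
  The proof is by contradiction: if \<open>Y\<close> fails the Radon--Nikodym property, some bounded operator
  \<open>T\<close> on \<open>L\<^sub>1(\<mu>)\<close> stays at a positive distance from every range strongly exposing operator.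

  Two facts pull in opposite directions.  On the one hand, a range strongly exposing operator \<open>S\<close>
  looks like a rank one operator somewhere.  It attains its norm at a unit vector \<open>f\<close>, the
  restrictions of \<open>f\<close> to measurable sets attain the norm after normalisation too, and the
  exposing property together with strict convexity of the scalar field forces
  \<open>S(1\<^sub>B f) = (\<integral>\<^sub>B |f|) S f\<close> for all \<open>B\<close> (\<open>RSE_rank_one_on_support\<close>).  On a set where \<open>f\<close> is
  nearly constant, \<open>S 1\<^sub>B\<close> is then nearly \<open>\<mu>(B) z\<close> for a fixed vector \<open>z\<close>
  (\<open>RSE_nearly_rank_one_piece\<close>).

  On the other hand, let \<open>G\<close> be a vector measure without a density with respect to \<open>\<nu>\<close>.  If every
  set of positive measure had subsets on which the averages \<open>G(B)/\<nu>(B)\<close> oscillate arbitrarily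
  little, a density could be glued together from nearly constant pieces
  (\<open>density_of_small_oscillation\<close>).  So there are \<open>\<epsilon> > 0\<close> and a set \<open>A\<close> such that the averages
  oscillate by more than \<open>\<epsilon>\<close> inside every subset of \<open>A\<close> of positive measure.  Partitioning again
  and again gives a tree of vectors, each the weighted mean of its children, in which most children
  are farther than \<open>\<epsilon>\<close> from their parent (\<open>oscillating_tree_exists\<close>).

  The tree is transported to an atomless set \<open>E\<close> of positive \<open>\<mu>\<close>-measure: by Sierpinski's theorem
  \<open>E\<close> splits into sets \<open>Q\<^sub>s\<close> with the prescribed weights.  Let
  \<open>T f = lim\<^sub>n \<Sum>\<^sub>s (\<integral>\<^bsub>Q\<^sub>s\<^esub> f) y\<^sub>s\<close>, the sum being over the nodes \<open>s\<close> of level \<open>n\<close>.  The limit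
  exists, although \<open>Y\<close> has no compactness to offer, since the conditional expectations of an
  indicator on the levels form a bounded martingale and so converge in \<open>L\<^sub>2\<close>
  (\<open>vanishing_oscillation\<close>).  The same convergence, applied to the indicator of an arbitrary set
  \<open>F \<subseteq> E\<close> of positive measure, shows that \<open>T 1\<^sub>B \<approx> \<mu>(B) z\<close> cannot hold with accuracy better than
  \<open>\<epsilon>/2\<close> for all \<open>B \<subseteq> F\<close> (\<open>no_rank_one_piece\<close>): otherwise the vectors of two consecutive deep
  levels would both be close to \<open>z\<close> over most of \<open>F\<close>, and hence close to each other.  A range strongly
  exposing operator close to \<open>T\<close> contradicts this.
\<close>

section \<open>Maximal sets, exhaustion and atomless measures\<close>

text \<open>
  A maximality principle in the style of Brezis and Browder: greedily choose an increasing sequence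
  that gains at least half of what can still be gained.  The gains of a bounded functional tend to
  zero, so nothing can be gained beyond the union.  It replaces Zorn's lemma both for families of sets
  (exhaustion) and for sets of points (Sierpinski's theorem).
\<close>

lemma exists_maximal_of_bounded_mono:
  fixes \<phi> :: "'b set \<Rightarrow> real"
  assumes "S0 \<in> X"
    and chain: "\<And>F. range F \<subseteq> X \<Longrightarrow> incseq F \<Longrightarrow> (\<Union>n::nat. F n) \<in> X"
    and mono: "\<And>S S'. S \<in> X \<Longrightarrow> S' \<in> X \<Longrightarrow> S \<subseteq> S' \<Longrightarrow> \<phi> S \<le> \<phi> S'"
    and bound: "\<And>S. S \<in> X \<Longrightarrow> \<phi> S \<le> C"
  obtains S where "S \<in> X" "\<And>S'. S' \<in> X \<Longrightarrow> S \<subseteq> S' \<Longrightarrow> \<phi> S' \<le> \<phi> S"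
proof -
  have step: "\<exists>S'. S' \<in> X \<and> S \<subseteq> S' \<and> (\<forall>U\<in>X. S \<subseteq> U \<longrightarrow> \<phi> U - \<phi> S \<le> 2 * (\<phi> S' - \<phi> S))"
    if S: "S \<in> X" for S
  proof -
    define s where "s = (SUP U\<in>{U\<in>X. S \<subseteq> U}. \<phi> U)"
    have bdd: "bdd_above (\<phi> ` {U\<in>X. S \<subseteq> U})" using bound by (auto intro!: bdd_aboveI)
    have upper: "\<phi> U \<le> s" if "U \<in> X" "S \<subseteq> U" for U
      unfolding s_def using that bdd by (intro cSUP_upper) auto
    show ?thesis
    proof (cases "\<phi> S < s")
      case True
      then have "(\<phi> S + s) / 2 < s" by simp
      then obtain S' where "S' \<in> X" "S \<subseteq> S'" "(\<phi> S + s) / 2 < \<phi> S'"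
        unfolding s_def using S bdd by (subst (asm) less_cSUP_iff) auto
      then show ?thesis using upper by (intro exI[of _ S']) fastforce
    next
      case False
      then show ?thesis using upper S by (intro exI[of _ S]) fastforce
    qed
  qed
  have "\<exists>F. \<forall>n::nat. F n \<in> X \<and> (F n \<subseteq> F (Suc n) \<and>
      (\<forall>U\<in>X. F n \<subseteq> U \<longrightarrow> \<phi> U - \<phi> (F n) \<le> 2 * (\<phi> (F (Suc n)) - \<phi> (F n))))"
    by (rule dependent_nat_choice) (use step \<open>S0 \<in> X\<close> in blast)+
  then obtain F where F0: "\<forall>n::nat. F n \<in> X \<and> (F n \<subseteq> F (Suc n) \<and>
      (\<forall>U\<in>X. F n \<subseteq> U \<longrightarrow> \<phi> U - \<phi> (F n) \<le> 2 * (\<phi> (F (Suc n)) - \<phi> (F n))))"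
    by (elim exE)
  then have F: "\<And>n::nat. F n \<in> X" "\<And>n. F n \<subseteq> F (Suc n)"
    "\<And>n U. U \<in> X \<Longrightarrow> F n \<subseteq> U \<Longrightarrow> \<phi> U - \<phi> (F n) \<le> 2 * (\<phi> (F (Suc n)) - \<phi> (F n))"
    by auto
  have inc: "incseq F" using F(2) by (simp add: incseq_SucI)
  define L where "L = (\<Union>n. F n)"
  have L: "L \<in> X" unfolding L_def using F(1) inc by (intro chain) auto
  have FL: "\<phi> (F n) \<le> \<phi> L" for n using F(1) L by (intro mono) (auto simp: L_def)
  have "incseq (\<lambda>n. \<phi> (F n))" using F(1,2) by (intro incseq_SucI mono) auto
  moreover have "\<forall>n. \<phi> (F n) \<le> C" using bound F(1) by simp
  ultimately obtain l where l: "(\<lambda>n. \<phi> (F n)) \<longlonglongrightarrow> l"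
    by (rule incseq_convergent)
  have lL: "l \<le> \<phi> L" using l FL by (auto intro: LIMSEQ_le_const2)
  show ?thesis
  proof (rule that[OF L])
    fix U assume U: "U \<in> X" "L \<subseteq> U"
    have "(\<lambda>n. \<phi> U - \<phi> (F n)) \<longlonglongrightarrow> \<phi> U - l" using l by (intro tendsto_intros)
    moreover have "(\<lambda>n. 2 * (\<phi> (F (Suc n)) - \<phi> (F n))) \<longlonglongrightarrow> 2 * (l - l)"
      using l LIMSEQ_Suc[OF l] by (intro tendsto_intros)
    ultimately have "\<phi> U - l \<le> 2 * (l - l)"
    proof (rule LIMSEQ_le)
      show "\<exists>N. \<forall>n\<ge>N. \<phi> U - \<phi> (F n) \<le> 2 * (\<phi> (F (Suc n)) - \<phi> (F n))"
        using F(3)[OF U(1)] U(2) unfolding L_def by blast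
    qed
    then show "\<phi> U \<le> \<phi> L" using lL by simp
  qed
qed

text \<open>
  A disjoint countable family that is maximal for the measure of its union leaves only a null set,
  for otherwise a further set could be cut out of the remainder.  The empty set serves to pad finite families to sequences.
\<close>

lemma (in finite_measure) exhaustion:
  assumes B: "B \<in> sets M" and "P {}"
    and pos: "\<And>D. D \<in> sets M \<Longrightarrow> D \<subseteq> B \<Longrightarrow> measure M D > 0 \<Longrightarrow>
      \<exists>C\<in>sets M. C \<subseteq> D \<and> measure M C > 0 \<and> P C"
  obtains C :: "nat \<Rightarrow> 'a set" where "\<And>i. C i \<in> sets M" "\<And>i. C i \<subseteq> B" "\<And>i. P (C i)"
    "disjoint_family C" "measure M (B - (\<Union>i. C i)) = 0"
proof -
  define X where "X = {\<F>. countable \<F> \<and> disjoint \<F> \<and> (\<forall>C\<in>\<F>. C \<in> sets M \<and> C \<subseteq> B \<and> P C)}"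
  have sets: "\<Union>\<F> \<in> sets M" if "\<F> \<in> X" for \<F>
    using that by (auto simp: X_def intro!: sets.countable_Union)
  obtain \<F> where \<F>: "\<F> \<in> X" and
    max: "\<And>\<G>. \<G> \<in> X \<Longrightarrow> \<F> \<subseteq> \<G> \<Longrightarrow> measure M (\<Union>\<G>) \<le> measure M (\<Union>\<F>)"
  proof (rule exists_maximal_of_bounded_mono[of "{}" X "\<lambda>\<F>. measure M (\<Union>\<F>)" "measure M (space M)"])
    show "{} \<in> X" by (simp add: X_def)
    fix F :: "nat \<Rightarrow> _" assume F: "range F \<subseteq> X" "incseq F"
    have "disjoint (\<Union>n. F n)"
    proof (rule disjointI)
      fix a b assume "a \<in> (\<Union>n. F n)" "b \<in> (\<Union>n. F n)" "a \<noteq> b"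
      then obtain i j where "a \<in> F i" "b \<in> F j" by auto
      then have "a \<in> F (max i j)" "b \<in> F (max i j)"
        using F(2) by (meson incseqD max.cobounded1 max.cobounded2 subsetD)+
      then show "a \<inter> b = {}" using F(1) \<open>a \<noteq> b\<close> by (auto simp: X_def disjoint_def)
    qed
    then show "(\<Union>n. F n) \<in> X" using F(1) by (auto simp: X_def)
  next
    show "measure M (\<Union>S) \<le> measure M (\<Union>S')" if "S \<in> X" "S' \<in> X" "S \<subseteq> S'" for S S'
      using that sets by (intro finite_measure_mono) auto
  qed (auto intro: bounded_measure that)
  define C where "C = (\<lambda>i. if i \<in> to_nat_on \<F> ` \<F> then from_nat_into \<F> i else {})"
  have cnt: "countable \<F>" using \<F> by (simp add: X_def)
  have Ceq: "C i = {} \<or> (C i \<in> \<F> \<and> to_nat_on \<F> (C i) = i)" for i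
    using cnt by (auto simp: C_def)
  have UC: "(\<Union>i. C i) = \<Union>\<F>"
  proof
    show "(\<Union>i. C i) \<subseteq> \<Union>\<F>" using Ceq by fastforce
    show "\<Union>\<F> \<subseteq> (\<Union>i. C i)"
    proof
      fix x assume "x \<in> \<Union>\<F>"
      then obtain D where D: "D \<in> \<F>" "x \<in> D" by auto
      then have "C (to_nat_on \<F> D) = D" using cnt by (auto simp: C_def)
      then show "x \<in> (\<Union>i. C i)" using D by auto
    qed
  qed
  have "measure M (B - \<Union>\<F>) = 0"
  proof (rule ccontr)
    assume "measure M (B - \<Union>\<F>) \<noteq> 0"
    then have "measure M (B - \<Union>\<F>) > 0" by (simp add: zero_less_measure_iff)
    then obtain D where D: "D \<in> sets M" "D \<subseteq> B - \<Union>\<F>" "measure M D > 0" "P D"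
      using pos[of "B - \<Union>\<F>"] B sets[OF \<F>] by auto
    have "insert D \<F> \<in> X" using \<F> D
      by (auto simp: X_def disjoint_def)
    then have "measure M (\<Union>(insert D \<F>)) \<le> measure M (\<Union>\<F>)" by (rule max) auto
    moreover have "measure M (D \<union> \<Union>\<F>) = measure M D + measure M (\<Union>\<F>)"
      using D sets[OF \<F>] by (intro finite_measure_Union) auto
    ultimately show False using D by simp
  qed
  moreover have "disjoint_family C"
    unfolding disjoint_family_on_def
  proof safe
    fix m n :: nat and x assume "m \<noteq> n" "x \<in> C m" "x \<in> C n"
    with Ceq[of m] Ceq[of n] have "C m \<in> \<F>" "C n \<in> \<F>" "C m \<noteq> C n" by auto
    then show "x \<in> {}" using \<F> \<open>x \<in> C m\<close> \<open>x \<in> C n\<close> by (auto simp: X_def disjoint_def)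
  qed
  moreover have "C i \<in> sets M" "C i \<subseteq> B" "P (C i)" for i
    using Ceq[of i] \<F> \<open>P {}\<close> by (auto simp: X_def)
  ultimately show ?thesis by (intro that[of C]) (simp_all add: UC)
qed

text \<open>
  A set that is not an atom splits into two sets of positive measure, the smaller of which has at
  most half of the measure.
\<close>

lemma (in finite_measure) atomless_small_subset:
  assumes "E \<in> sets M" "\<And>A. A \<subseteq> E \<Longrightarrow> \<not> is_atom M A"
    and D: "D \<in> sets M" "D \<subseteq> E" "measure M D > 0" and "r > 0"
  obtains R where "R \<in> sets M" "R \<subseteq> D" "0 < measure M R" "measure M R \<le> r"
proof -
  have "\<exists>R\<in>sets M. R \<subseteq> D \<and> 0 < measure M R \<and> measure M R \<le> measure M D / 2 ^ n" for n
  proof (induction n)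
    case 0
    then show ?case using D by auto
  next
    case (Suc n)
    then obtain R where R: "R \<in> sets M" "R \<subseteq> D" "0 < measure M R" "measure M R \<le> measure M D / 2 ^ n"
      by auto
    have "\<not> is_atom M R" using assms(2) R(2) D(2) by auto
    then obtain B where B: "B \<in> sets M" "B \<subseteq> R" "measure M B > 0" "measure M (R - B) > 0"
      using R by (auto simp: is_atom_def emeasure_eq_measure zero_less_measure_iff)
    have eq: "measure M (R - B) = measure M R - measure M B"
      using R B by (intro finite_measure_Diff) auto
    have "measure M B \<le> measure M D / 2 ^ Suc n \<or> measure M (R - B) \<le> measure M D / 2 ^ Suc n"
      using R(4) unfolding eq by (auto simp: field_simps)
    then show ?case
    proof
      assume "measure M B \<le> measure M D / 2 ^ Suc n"
      then show ?case using B R by auto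
    next
      assume "measure M (R - B) \<le> measure M D / 2 ^ Suc n"
      then show ?case using B R by (intro bexI[of _ "R - B"]) auto
    qed
  qed
  moreover obtain n where "(1/2) ^ n < r / measure M D"
    using real_arch_pow_inv[of "r / measure M D" "1/2"] D \<open>r > 0\<close> by auto
  then have "measure M D / 2 ^ n < r" using D by (simp add: field_simps)
  ultimately show ?thesis using that by (meson less_imp_le order_trans)
qed

text \<open>
  Sierpinski's theorem: among the subsets of measure at most \<open>r\<close> take a maximal one.  If its
  measure fell short of \<open>r\<close>, a small subset of the complement could be added.
\<close>

lemma (in finite_measure) atomless_subset_of_measure:
  assumes E: "E \<in> sets M" "\<And>A. A \<subseteq> E \<Longrightarrow> \<not> is_atom M A"
    and Q: "Q \<in> sets M" "Q \<subseteq> E" and r: "0 \<le> r" "r \<le> measure M Q"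
  obtains R where "R \<in> sets M" "R \<subseteq> Q" "measure M R = r"
proof -
  define X where "X = {R\<in>sets M. R \<subseteq> Q \<and> measure M R \<le> r}"
  obtain R where R: "R \<in> X" and max: "\<And>R'. R' \<in> X \<Longrightarrow> R \<subseteq> R' \<Longrightarrow> measure M R' \<le> measure M R"
  proof (rule exists_maximal_of_bounded_mono[of "{}" X "measure M" r])
    show "{} \<in> X" using r by (simp add: X_def)
    fix F :: "nat \<Rightarrow> _" assume F: "range F \<subseteq> X" "incseq F"
    have "(\<lambda>n. measure M (F n)) \<longlonglongrightarrow> measure M (\<Union>n. F n)"
      using F by (intro finite_Lim_measure_incseq) (auto simp: X_def)
    then have "measure M (\<Union>n. F n) \<le> r"
      by (rule LIMSEQ_le_const2) (use F(1) in \<open>auto simp: X_def\<close>)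
    then show "(\<Union>n. F n) \<in> X" using F(1) by (auto simp: X_def)
  next
    show "measure M S \<le> measure M S'" if "S \<in> X" "S' \<in> X" "S \<subseteq> S'" for S S'
      using that by (intro finite_measure_mono) (auto simp: X_def)
  qed (auto simp: X_def intro: that)
  have "measure M R = r"
  proof (rule ccontr)
    assume "measure M R \<noteq> r"
    then have lt: "measure M R < r" using R by (auto simp: X_def)
    have "measure M (Q - R) = measure M Q - measure M R"
      using R Q by (intro finite_measure_Diff) (auto simp: X_def)
    then have "measure M (Q - R) > 0" using lt r by simp
    moreover have "Q - R \<in> sets M" "Q - R \<subseteq> E" using R Q by (auto simp: X_def)
    ultimately obtain D where D: "D \<in> sets M" "D \<subseteq> Q - R" "0 < measure M D" "measure M D \<le> r - measure M R"
      using atomless_small_subset[OF E, of "Q - R" "r - measure M R"] lt by auto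
    have eq: "measure M (R \<union> D) = measure M R + measure M D"
      using D R by (intro finite_measure_Union) (auto simp: X_def)
    then have "R \<union> D \<in> X" using D R by (auto simp: X_def)
    then show False using max[of "R \<union> D"] eq D by auto
  qed
  then show ?thesis using that R by (auto simp: X_def)
qed

lemma (in finite_measure) atomless_partition:
  fixes k :: nat
  assumes E: "E \<in> sets M" "\<And>A. A \<subseteq> E \<Longrightarrow> \<not> is_atom M A"
    and "0 < k" "Q \<in> sets M" "Q \<subseteq> E"
    and "\<And>i. i < k \<Longrightarrow> 0 \<le> w i" "(\<Sum>i<k. w i) = measure M Q"
  shows "\<exists>C. (\<forall>i<k. C i \<in> sets M \<and> measure M (C i) = w i) \<and> disjoint_family_on C {..<k}
    \<and> (\<Union>i<k. C i) = Q"
  using assms(3-)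
proof (induction k arbitrary: Q rule: nat_induct_non_zero)
  case 1
  then show ?case by (intro exI[of _ "\<lambda>_. Q"]) (auto simp: disjoint_family_on_def)
next
  case (Suc k)
  have "0 \<le> (\<Sum>i<k. w i)" using Suc.prems by (intro sum_nonneg) auto
  then have "0 \<le> w k" "w k \<le> measure M Q" using Suc.prems(3,4) by auto
  then obtain R where R: "R \<in> sets M" "R \<subseteq> Q" "measure M R = w k"
    using atomless_subset_of_measure[OF E Suc.prems(1,2), of "w k"] by blast
  have "measure M (Q - R) = measure M Q - measure M R"
    using R Suc.prems by (intro finite_measure_Diff) auto
  then have "(\<Sum>i<k. w i) = measure M (Q - R)" using Suc.prems(4) R by simp
  then obtain C where C: "\<forall>i<k. C i \<in> sets M \<and> measure M (C i) = w i" "disjoint_family_on C {..<k}"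
    "(\<Union>i<k. C i) = Q - R"
    using Suc.IH[of "Q - R"] Suc.prems R by (auto simp: less_Suc_eq subset_iff)
  have sub: "C i \<inter> R = {}" if "i < k" for i using C(3) that by blast
  have "disjoint_family_on (C(k := R)) {..<Suc k}"
  proof (unfold disjoint_family_on_def, intro ballI impI)
    fix i j assume "i \<in> {..<Suc k}" "j \<in> {..<Suc k}" "i \<noteq> j"
    then show "(C(k := R)) i \<inter> (C(k := R)) j = {}"
      using disjoint_family_onD[OF C(2), of i j] sub[of i] sub[of j]
      by (cases "i = k"; cases "j = k") (auto simp: less_Suc_eq Int_commute)
  qed
  moreover
  have "(\<Union>i<Suc k. (C(k := R)) i) = (\<Union>i<k. C i) \<union> R"
    by (auto simp: lessThan_Suc)
  then have "(\<Union>i<Suc k. (C(k := R)) i) = Q" using C(3) R(2) by auto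
  moreover have "\<forall>i<Suc k. (C(k := R)) i \<in> sets M \<and> measure M ((C(k := R)) i) = w i"
    using R C(1) by (auto simp: less_Suc_eq)
  ultimately show ?case by blast
qed

section \<open>Vector measures without a density\<close>

lemma (in finite_measure) simple_bochner_sum_indicator:
  fixes y :: "'i \<Rightarrow> 'y::real_normed_vector"
  assumes "finite I" "\<And>i. i \<in> I \<Longrightarrow> A i \<in> sets M"
  shows "Bochner_Integration.simple_bochner_integrable M (\<lambda>x. \<Sum>i\<in>I. indicator (A i) x *\<^sub>R y i) \<and>
    Bochner_Integration.simple_bochner_integral M (\<lambda>x. \<Sum>i\<in>I. indicator (A i) x *\<^sub>R y i)
      = (\<Sum>i\<in>I. measure M (A i) *\<^sub>R y i)"
  using assms
proof (induction I)
  case empty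
  have "Bochner_Integration.simple_bochner_integrable M (\<lambda>x. 0 :: 'y)"
    by (auto intro!: simple_bochner_integrable.intros)
  moreover have "Bochner_Integration.simple_bochner_integral M (\<lambda>x. 0 :: 'y) = 0"
    unfolding simple_bochner_integral_def by (intro sum.neutral) auto
  ultimately show ?case by simp
next
  case (insert i I)
  have ind: "Bochner_Integration.simple_bochner_integrable M (indicator (A i) :: 'a \<Rightarrow> real)"
    using insert.prems by (intro simple_bochner_integrable.intros simple_function_indicator) auto
  have "Bochner_Integration.simple_bochner_integral M (indicator (A i) :: 'a \<Rightarrow> real)
      = (\<Sum>r\<in>{0, 1 :: real}. measure M {x \<in> space M. indicator (A i) x = r} *\<^sub>R r)"
    unfolding simple_bochner_integral_def
  proof (rule sum.mono_neutral_left)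
    show "(indicator (A i) :: 'a \<Rightarrow> real) ` space M \<subseteq> {0, 1}"
      by (auto simp: indicator_def)
    show "\<forall>r\<in>{0, 1} - (indicator (A i) :: 'a \<Rightarrow> real) ` space M.
        measure M {x \<in> space M. indicator (A i) x = r} *\<^sub>R r = 0"
    proof
      fix r :: real assume "r \<in> {0, 1} - indicator (A i) ` space M"
      then have "r = 0 \<or> {x \<in> space M. indicator (A i) x = r} = {}" by auto
      then show "measure M {x \<in> space M. indicator (A i) x = r} *\<^sub>R r = 0"
        by (metis measure_empty scaleR_zero_left scaleR_zero_right)
    qed
  qed simp
  also have "\<dots> = measure M {x \<in> space M. indicator (A i) x = (1::real)}" by simp
  also have "{x \<in> space M. indicator (A i) x = (1::real)} = A i"
    using insert.prems sets.sets_into_space by (auto simp: indicator_def split: if_splits)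
  finally have ind_int:
    "Bochner_Integration.simple_bochner_integral M (indicator (A i) :: 'a \<Rightarrow> real) = measure M (A i)" .
  have lin: "linear (\<lambda>r. r *\<^sub>R y i)" by (simp add: linear_iff algebra_simps)
  have 1: "Bochner_Integration.simple_bochner_integrable M (\<lambda>x. indicator (A i) x *\<^sub>R y i)"
    by (rule simple_bochner_integrable_compose2[OF _ ind ind, of "\<lambda>r _. r *\<^sub>R y i"]) simp
  have 2: "Bochner_Integration.simple_bochner_integral M (\<lambda>x. indicator (A i) x *\<^sub>R y i)
      = measure M (A i) *\<^sub>R y i"
    using simple_bochner_integral_linear[OF lin ind] ind_int by simp
  have IH: "Bochner_Integration.simple_bochner_integrable M (\<lambda>x. \<Sum>i\<in>I. indicator (A i) x *\<^sub>R y i)"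
    "Bochner_Integration.simple_bochner_integral M (\<lambda>x. \<Sum>i\<in>I. indicator (A i) x *\<^sub>R y i)
      = (\<Sum>i\<in>I. measure M (A i) *\<^sub>R y i)"
    using insert by auto
  show ?case
    using simple_bochner_integrable_compose2[OF _ 1 IH(1), of "(+)"]
      simple_bochner_integral_add[OF 1 IH(1)] 2 IH(2)
    unfolding sum.insert[OF insert.hyps] by (simp del: sum_indicator_scaleR)
qed

locale continuous_vector_measure = finite_measure N for N :: "'w measure" +
  fixes G :: "'w set \<Rightarrow> 'y::banach"
  assumes vector_measure: "vector_measure N G"
    and continuous: "measure_continuous N G"
begin

lemma G_null:
  assumes "A \<in> sets N" "measure N A = 0"
  shows "G A = 0"
proof (rule ccontr)
  assume "G A \<noteq> 0"
  then have "norm (G A) > 0" by simp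
  then obtain \<delta> where "\<delta> > 0" "\<forall>E\<in>sets N. measure N E < \<delta> \<longrightarrow> norm (G E) < norm (G A)"
    using continuous unfolding measure_continuous_def by blast
  then show False using assms by auto
qed

lemma G_empty [simp]: "G {} = 0"
  by (rule G_null) auto

lemma G_Un:
  assumes "A \<in> sets N" "B \<in> sets N" "A \<inter> B = {}"
  shows "G (A \<union> B) = G A + G B"
proof -
  have "range (binaryset A B) \<subseteq> sets N" using assms by (simp add: range_binaryset_eq)
  moreover have "disjoint_family (binaryset A B)"
    using assms(3) by (auto simp: disjoint_family_on_def binaryset_def)
  ultimately have "(\<lambda>i. G (binaryset A B i)) sums G (\<Union>i. binaryset A B i)"
    using vector_measure unfolding vector_measure_def by blast
  moreover have "(\<lambda>i. G (binaryset A B i)) sums (G A + G B)"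
    by (rule binaryset_sums) simp
  ultimately show ?thesis by (simp add: UN_binaryset_eq sums_unique2)
qed

lemma G_UN:
  assumes "finite I" "disjoint_family_on C I" "\<And>i. i \<in> I \<Longrightarrow> C i \<in> sets N"
  shows "G (\<Union>i\<in>I. C i) = (\<Sum>i\<in>I. G (C i))"
  using assms
proof (induction I)
  case (insert i I)
  have "G (C i \<union> (\<Union>i\<in>I. C i)) = G (C i) + G (\<Union>i\<in>I. C i)"
    using insert by (intro G_Un) (auto simp: disjoint_family_on_def)
  then show ?case using insert by (simp add: disjoint_family_on_def)
qed simp

lemma sum_norm_le_variation:
  assumes V: "\<And>P. finite P \<Longrightarrow> P \<subseteq> sets N \<Longrightarrow> partition_on (space N) P \<Longrightarrow>
      (\<Sum>A\<in>P. norm (G A)) \<le> V"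
    and I: "finite I" "disjoint_family_on C I" "\<And>i. i \<in> I \<Longrightarrow> C i \<in> sets N"
  shows "(\<Sum>i\<in>I. norm (G (C i))) \<le> V"
proof -
  define J where "J = {i\<in>I. C i \<noteq> {}}"
  define P where "P = (C ` J \<union> {space N - (\<Union>i\<in>I. C i)}) - {{}}"
  have inj: "inj_on C J"
  proof (rule inj_onI)
    fix i j assume "i \<in> J" "j \<in> J" "C i = C j"
    then show "i = j" using I(2) by (auto simp: J_def disjoint_family_on_def)
  qed
  have "partition_on (space N) P"
  proof (rule partition_onI)
    have "\<Union>(X - {{}}) = \<Union>X" for X :: "'w set set" by auto
    moreover have "(\<Union>i\<in>J. C i) = (\<Union>i\<in>I. C i)" by (auto simp: J_def)
    ultimately have "\<Union>P = (\<Union>i\<in>I. C i) \<union> (space N - (\<Union>i\<in>I. C i))"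
      unfolding P_def by (simp only: Union_Un_distrib ccpo_Sup_singleton)
    moreover have "(\<Union>i\<in>I. C i) \<subseteq> space N" using I(3) sets.sets_into_space by blast
    ultimately show "\<Union>P = space N" by blast
    show "disjnt p q" if "p \<in> P" "q \<in> P" "p \<noteq> q" for p q
    proof -
      have *: "disjnt (C i) (C j)" if "i \<in> I" "j \<in> I" "C i \<noteq> C j" for i j
        using that disjoint_family_onD[OF I(2), of i j] by (auto simp: disjnt_def)
      have **: "disjnt (C i) (space N - (\<Union>i\<in>I. C i))" if "i \<in> I" for i
        using that by (auto simp: disjnt_def)
      have cases: "(\<exists>i\<in>I. x = C i) \<or> x = space N - (\<Union>i\<in>I. C i)" if "x \<in> P" for x
        using that by (auto simp: P_def J_def)
      show ?thesis
        using cases[OF that(1)] cases[OF that(2)]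
        by (elim disjE bexE) (use * **[THEN disjnt_sym] ** that(3) in \<open>simp_all\<close>)
    qed
  qed (auto simp: P_def)
  moreover have "space N - (\<Union>i\<in>I. C i) \<in> sets N" using I by auto
  ultimately have *: "(\<Sum>A\<in>P. norm (G A)) \<le> V"
    using I by (intro V) (auto simp: P_def J_def)
  have "(\<Sum>i\<in>I. norm (G (C i))) = (\<Sum>i\<in>J. norm (G (C i)))"
    using I by (intro sum.mono_neutral_right) (auto simp: J_def)
  also have "\<dots> = (\<Sum>A\<in>C ` J. norm (G A))"
    using inj by (simp add: sum.reindex)
  also have "\<dots> \<le> (\<Sum>A\<in>P. norm (G A))"
    using I by (intro sum_mono2) (auto simp: P_def J_def)
  finally show ?thesis using * by simp
qed

text \<open>
  This stands in for the Radon--Nikodym derivative of the variation of \<open>G\<close>: if \<open>G\<close> exceeded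
  \<open>K \<nu>\<close> on a piece of every set of positive measure, exhausting \<open>A\<close> by such pieces would make the
  variation at least \<open>K \<nu>(A)\<close>, which is too large for the chosen \<open>K\<close>.
\<close>

lemma locally_lipschitz:
  assumes V: "bounded_variation N G" and A: "A \<in> sets N" "measure N A > 0"
  obtains B K where "B \<in> sets N" "B \<subseteq> A" "measure N B > 0" "K > 0"
    "\<And>C. C \<in> sets N \<Longrightarrow> C \<subseteq> B \<Longrightarrow> norm (G C) \<le> K * measure N C"
proof -
  obtain V where V: "\<And>P. finite P \<Longrightarrow> P \<subseteq> sets N \<Longrightarrow> partition_on (space N) P \<Longrightarrow>
      (\<Sum>A\<in>P. norm (G A)) \<le> V"
    using V by (auto simp: bounded_variation_def)
  \<comment> \<open>any \<open>K\<close> with \<open>K \<nu>(A)\<close> larger than the variation will do\<close>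
  define K where "K = (\<bar>V\<bar> + 1) / measure N A"
  have K: "K > 0" "V < K * measure N A" using A by (auto simp: K_def)
  have "\<exists>B\<in>sets N. B \<subseteq> A \<and> measure N B > 0 \<and>
      (\<forall>C\<in>sets N. C \<subseteq> B \<longrightarrow> norm (G C) \<le> K * measure N C)"
  proof (rule ccontr)
    assume none: "\<not> ?thesis"
    obtain C where C: "\<And>i::nat. C i \<in> sets N" "\<And>i. C i \<subseteq> A"
      "\<And>i. norm (G (C i)) \<ge> K * measure N (C i)"
      "disjoint_family C" "measure N (A - (\<Union>i. C i)) = 0"
    proof (rule exhaustion[of A "\<lambda>C. norm (G C) \<ge> K * measure N C"])
      fix D assume D: "D \<in> sets N" "D \<subseteq> A" "measure N D > 0"
      then obtain C where C: "C \<in> sets N" "C \<subseteq> D" "norm (G C) > K * measure N C"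
        using none by (metis not_le)
      then have "measure N C > 0"
        using G_null[of C] by (cases "measure N C = 0") (auto simp: zero_less_measure_iff)
      then show "\<exists>C\<in>sets N. C \<subseteq> D \<and> 0 < measure N C \<and> K * measure N C \<le> norm (G C)"
        using C by auto
    qed (use A in \<open>auto\<close>)
    have "(\<lambda>n. measure N (C n)) sums measure N (\<Union>i. C i)"
      using C by (intro finite_measure_UNION) auto
    moreover have "measure N (\<Union>i. C i) = measure N A"
      using C(1,2,5) A finite_measure_Diff[of A "\<Union>i. C i"] by (simp add: UN_subset_iff)
    ultimately have "(\<lambda>n. \<Sum>i<n. measure N (C i)) \<longlonglongrightarrow> measure N A"
      by (simp add: sums_def)
    then have "(\<lambda>n. K * (\<Sum>i<n. measure N (C i))) \<longlonglongrightarrow> K * measure N A"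
      by (intro tendsto_intros)
    moreover have "K * (\<Sum>i<n. measure N (C i)) \<le> V" for n
    proof -
      have "K * (\<Sum>i<n. measure N (C i)) \<le> (\<Sum>i<n. norm (G (C i)))"
        unfolding sum_distrib_left by (intro sum_mono C)
      also have "\<dots> \<le> V"
        using C by (intro sum_norm_le_variation[OF V] disjoint_family_on_mono[OF _ C(4)]) auto
      finally show ?thesis .
    qed
    ultimately have "K * measure N A \<le> V" by (auto intro: LIMSEQ_le_const2)
    then show False using K by simp
  qed
  then show ?thesis using that K by blast
qed

text \<open>
  For every \<open>k\<close> the space is exhausted by sets \<open>C k i\<close> on which the averages of \<open>G\<close> differ from a
  vector \<open>y k i\<close> by at most \<open>2\<^sup>-\<^sup>k\<close>.  The functions equal to \<open>y k i\<close> on \<open>C k i\<close> form a uniform Cauchy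
  sequence off a null set, and their limit \<open>g\<close> is the density.  Simple functions are obtained by
  keeping only the first \<open>m k\<close> pieces; bounded variation makes the discarded part small in \<open>L\<^sub>1\<close>.
\<close>

lemma density_of_small_oscillation:
  assumes V: "bounded_variation N G"
    and osc: "\<And>\<epsilon> D. \<epsilon> > 0 \<Longrightarrow> D \<in> sets N \<Longrightarrow> measure N D > 0 \<Longrightarrow>
      \<exists>C\<in>sets N. C \<subseteq> D \<and> measure N C > 0 \<and>
        (\<exists>y. \<forall>B\<in>sets N. B \<subseteq> C \<longrightarrow> norm (G B - measure N B *\<^sub>R y) \<le> \<epsilon> * measure N B)"
  shows "\<exists>g. bochner_integrable N g \<and>
      (\<forall>E\<in>sets N. has_bochner N (\<lambda>x. indicator E x *\<^sub>R g x) (G E))"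
proof -
  obtain V where V: "\<And>P. finite P \<Longrightarrow> P \<subseteq> sets N \<Longrightarrow> partition_on (space N) P \<Longrightarrow>
      (\<Sum>A\<in>P. norm (G A)) \<le> V"
    using V by (auto simp: bounded_variation_def)
  define small where "small = (\<lambda>k C y. \<forall>B\<in>sets N. B \<subseteq> C \<longrightarrow>
    norm (G B - measure N B *\<^sub>R y) \<le> (1/2::real) ^ k * measure N B)"
  have "\<exists>C y. (\<forall>i. C i \<in> sets N \<and> small k (C i) (y i)) \<and> disjoint_family C \<and>
      measure N (space N - (\<Union>i::nat. C i)) = 0" for k :: nat
  proof -
    obtain C where C: "\<And>i::nat. C i \<in> sets N" "\<And>i. \<exists>y. small k (C i) y"
      "disjoint_family C" "measure N (space N - (\<Union>i. C i)) = 0"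
    proof (rule exhaustion[of "space N" "\<lambda>C. \<exists>y. small k C y"])
      show "\<exists>y. small k {} y" by (auto simp: small_def)
      show "\<exists>C\<in>sets N. C \<subseteq> D \<and> 0 < measure N C \<and> (\<exists>y. small k C y)"
        if "D \<in> sets N" "0 < measure N D" for D
        using osc[OF _ that, of "(1/2) ^ k"] unfolding small_def by simp
    qed auto
    then show ?thesis by metis
  qed
  then obtain C y where C: "\<And>k i. C k i \<in> sets N" "\<And>k i. small k (C k i) (y k i)"
      "\<And>k. disjoint_family (C k)" "\<And>k. measure N (space N - (\<Union>i::nat. C k i)) = 0"
    by metis
  have small: "norm (G B - measure N B *\<^sub>R y k i) \<le> (1/2) ^ k * measure N B"
    if "B \<in> sets N" "B \<subseteq> C k i" for B k i
    using C(2) that by (auto simp: small_def)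
  have sum_le: "(\<Sum>i<n. measure N (C k i)) \<le> measure N (space N)" for n k
  proof -
    have "(\<Sum>i<n. measure N (C k i)) = measure N (\<Union>i<n. C k i)"
      using C by (intro finite_measure_finite_Union[symmetric] disjoint_family_on_mono[OF _ C(3)]) auto
    then show ?thesis using bounded_measure by simp
  qed
  have summ: "summable (\<lambda>i. norm (y k i) * measure N (C k i))" for k
  proof (rule summableI_nonneg_bounded)
    show "(\<Sum>i<n. norm (y k i) * measure N (C k i)) \<le> V + (1/2) ^ k * measure N (space N)" for n
    proof -
      have "norm (y k i) * measure N (C k i) \<le> norm (G (C k i)) + (1/2) ^ k * measure N (C k i)" for i
        using small[of "C k i" k i] C(1) norm_triangle_ineq3[of "G (C k i)" "measure N (C k i) *\<^sub>R y k i"]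
        by (auto simp: mult.commute)
      then have "(\<Sum>i<n. norm (y k i) * measure N (C k i))
          \<le> (\<Sum>i<n. norm (G (C k i)) + (1/2) ^ k * measure N (C k i))"
        by (intro sum_mono)
      also have "\<dots> = (\<Sum>i<n. norm (G (C k i))) + (1/2) ^ k * (\<Sum>i<n. measure N (C k i))"
        by (simp add: sum.distrib sum_distrib_left)
      also have "\<dots> \<le> V + (1/2) ^ k * measure N (space N)"
        using C sum_le by (intro add_mono mult_left_mono sum_norm_le_variation[OF V]
            disjoint_family_on_mono[OF _ C(3)]) auto
      finally show ?thesis .
    qed
  qed simp
  define R where "R = (\<lambda>k m. space N - (\<Union>i<m. C k i))"
  have R_sets: "R k m \<in> sets N" for k m using C by (auto simp: R_def)
  have R_lim: "(\<lambda>m. measure N (R k m)) \<longlonglongrightarrow> 0" for k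
  proof -
    have "(\<lambda>m. measure N (R k m)) \<longlonglongrightarrow> measure N (\<Inter>m. R k m)"
      using R_sets by (intro finite_Lim_measure_decseq) (auto simp: decseq_def R_def)
    also have "(\<Inter>m. R k m) = space N - (\<Union>i. C k i)" by (auto simp: R_def)
    finally show ?thesis using C(4) by simp
  qed
  have "\<exists>m. measure N (R k m) \<le> (1/2) ^ k \<and>
      (\<Sum>i. norm (y k (i + m)) * measure N (C k (i + m))) \<le> (1/2) ^ k" for k
  proof -
    \<comment> \<open>one index serves two purposes: small measure gives convergence almost everywhere by Borel--Cantelli,
      small \<open>L\<^sub>1\<close> norm gives convergence of the integrals\<close>
    obtain m1 where m1: "\<And>m. m \<ge> m1 \<Longrightarrow> measure N (R k m) < (1/2) ^ k"
      using order_tendstoD(2)[OF R_lim[of k], of "(1/2)^k"] by (auto simp: eventually_sequentially)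
    obtain m2 where m2: "\<And>m. m \<ge> m2 \<Longrightarrow>
        norm (\<Sum>i. norm (y k (i + m)) * measure N (C k (i + m))) < (1/2) ^ k"
      using suminf_exist_split[OF _ summ[of k], of "(1/2)^k"] by auto
    show ?thesis using m1[of "max m1 m2"] m2[of "max m1 m2"] by (intro exI[of _ "max m1 m2"]) auto
  qed
  then obtain m where m: "\<And>k. measure N (R k (m k)) \<le> (1/2) ^ k"
    "\<And>k. (\<Sum>i. norm (y k (i + m k)) * measure N (C k (i + m k))) \<le> (1/2) ^ k"
    by metis
  have close: "norm (y k i - y l j) \<le> (1/2) ^ k + (1/2) ^ l"
    if "measure N (C k i \<inter> C l j) > 0" for k l i j
  proof -
    let ?B = "C k i \<inter> C l j"
    have "norm (G ?B - measure N ?B *\<^sub>R y l j - (G ?B - measure N ?B *\<^sub>R y k i))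
        \<le> (1/2) ^ l * measure N ?B + (1/2) ^ k * measure N ?B"
      using C by (intro order_trans[OF norm_triangle_ineq4] add_mono small) auto
    also have "G ?B - measure N ?B *\<^sub>R y l j - (G ?B - measure N ?B *\<^sub>R y k i)
        = measure N ?B *\<^sub>R (y k i - y l j)" by (simp add: algebra_simps)
    finally have "measure N ?B * norm (y k i - y l j) \<le> measure N ?B * ((1/2) ^ k + (1/2) ^ l)"
      by (simp add: distrib_left mult.commute add.commute)
    then show ?thesis using that by simp
  qed
  have AE1: "AE x in N. \<forall>k. \<exists>i. x \<in> C k i"
  proof -
    have "AE x in N. \<exists>i. x \<in> C k i" for k
    proof (rule AE_I[where N = "space N - (\<Union>i. C k i)"])
      show "emeasure N (space N - (\<Union>i. C k i)) = 0" using C(4) by (simp add: emeasure_eq_measure)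
    qed (use C in auto)
    then show ?thesis by (simp add: AE_all_countable)
  qed
  have AE2: "AE x in N. \<forall>k i l j. x \<in> C k i \<longrightarrow> x \<in> C l j \<longrightarrow> norm (y k i - y l j) \<le> (1/2) ^ k + (1/2) ^ l"
  proof -
    have "AE x in N. x \<in> C k i \<longrightarrow> x \<in> C l j \<longrightarrow> norm (y k i - y l j) \<le> (1/2) ^ k + (1/2) ^ l" for k i l j
    proof (cases "measure N (C k i \<inter> C l j) > 0")
      case True
      then show ?thesis using close by simp
    next
      case False
      then have "C k i \<inter> C l j \<in> null_sets N"
        using C by (auto simp: null_sets_def emeasure_eq_measure zero_less_measure_iff)
      then have "AE x in N. x \<notin> C k i \<inter> C l j" by (rule AE_not_in)
      then show ?thesis by eventually_elim auto
    qed
    then show ?thesis unfolding AE_all_countable by blast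
  qed
  have AE3: "AE x in N. eventually (\<lambda>k. x \<in> space N - R k (m k)) sequentially"
  proof (rule borel_cantelli_AE1)
    show "summable (\<lambda>k. measure N (R k (m k)))"
      by (rule summable_comparison_test'[of "\<lambda>k. (1/2) ^ k"]) (use m in \<open>auto simp: summable_geometric\<close>)
  qed (use R_sets in \<open>auto simp: less_top[symmetric]\<close>)
  define idx where "idx = (\<lambda>k x. SOME i. x \<in> C k i)"
  define g where "g = (\<lambda>x. lim (\<lambda>k. y k (idx k x)))"
  have AEg: "AE x in N. \<forall>k i. x \<in> C k i \<longrightarrow> norm (g x - y k i) \<le> (1/2) ^ k"
    using AE1 AE2
  proof eventually_elim
    case (elim x)
    have idx: "x \<in> C k (idx k x)" for k unfolding idx_def using elim(1) by (metis someI)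
    have near: "norm (y k i - y l (idx l x)) \<le> (1/2) ^ k + (1/2) ^ l" if "x \<in> C k i" for k i l
      using elim(2) idx that by blast
    have "Cauchy (\<lambda>k. y k (idx k x))"
    proof (rule metric_CauchyI)
      fix e :: real assume "e > 0"
      then obtain K where K: "(1/2) ^ K < e / 2" using real_arch_pow_inv[of "e/2" "1/2"] by auto
      have "dist (y k (idx k x)) (y l (idx l x)) < e" if "k \<ge> K" "l \<ge> K" for k l
      proof -
        have "(1/2::real) ^ k \<le> (1/2) ^ K" "(1/2::real) ^ l \<le> (1/2) ^ K"
          using that by (auto intro!: power_decreasing)
        then show ?thesis unfolding dist_norm using near[OF idx, of k l] K by linarith
      qed
      then show "\<exists>M. \<forall>m\<ge>M. \<forall>n\<ge>M. dist (y m (idx m x)) (y n (idx n x)) < e" by blast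
    qed
    then have lim: "(\<lambda>k. y k (idx k x)) \<longlonglongrightarrow> g x"
      unfolding g_def by (simp add: Cauchy_convergent convergent_LIMSEQ_iff[symmetric])
    show ?case
    proof (intro allI impI)
      fix k i assume "x \<in> C k i"
      have "(\<lambda>l. norm (y k i - y l (idx l x))) \<longlonglongrightarrow> norm (y k i - g x)"
        using lim by (intro tendsto_intros)
      moreover have "(\<lambda>l. (1/2) ^ k + (1/2) ^ l :: real) \<longlonglongrightarrow> (1/2) ^ k + 0"
        by (intro tendsto_intros LIMSEQ_power_zero) auto
      ultimately have "norm (y k i - g x) \<le> (1/2) ^ k + 0"
        by (rule LIMSEQ_le) (use near[OF \<open>x \<in> C k i\<close>] in auto)
      then show "norm (g x - y k i) \<le> (1/2) ^ k" by (simp add: norm_minus_commute)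
    qed
  qed
  \<comment> \<open>the simple functions approximating \<open>1\<^sub>E g\<close>\<close>
  define s where "s = (\<lambda>E k x. \<Sum>i<m k. indicator (E \<inter> C k i) x *\<^sub>R y k i)"
  have s_simple: "Bochner_Integration.simple_bochner_integrable N (s E k)"
    "Bochner_Integration.simple_bochner_integral N (s E k) = (\<Sum>i<m k. measure N (E \<inter> C k i) *\<^sub>R y k i)"
    if "E \<in> sets N" for E k
    using simple_bochner_sum_indicator[of "{..<m k}" "\<lambda>i. E \<inter> C k i" "y k"] that C(1)
    unfolding s_def by auto
  have s_eq: "s E k x = (if i < m k then indicator E x *\<^sub>R y k i else 0)" if "x \<in> C k i" for E k x i
  proof -
    have "indicator (E \<inter> C k j) x *\<^sub>R y k j = (if j = i then indicator E x *\<^sub>R y k i else 0)" for j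
      using that disjoint_family_onD[OF C(3), of j i] by (auto simp: indicator_def)
    then show ?thesis unfolding s_def by simp
  qed
  have lim: "AE x in N. (\<lambda>k. s E k x) \<longlonglongrightarrow> indicator E x *\<^sub>R g x" for E
    using AE_space AE1 AE3 AEg
  proof eventually_elim
    case (elim x)
    have "eventually (\<lambda>k. norm (s E k x - indicator E x *\<^sub>R g x) \<le> (1/2) ^ k) sequentially"
      using elim(3)
    proof eventually_elim
      case (elim k)
      then obtain i where "i < m k" "x \<in> C k i" by (auto simp: R_def)
      then show ?case
        using s_eq[of x k i E] \<open>\<forall>k i. x \<in> C k i \<longrightarrow> norm (g x - y k i) \<le> (1/2) ^ k\<close>
        by (auto simp: indicator_def norm_minus_commute)
    qed
    moreover have "(\<lambda>k. (1/2::real) ^ k) \<longlonglongrightarrow> 0" by (intro LIMSEQ_power_zero) auto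
    ultimately have "(\<lambda>k. s E k x - indicator E x *\<^sub>R g x) \<longlonglongrightarrow> 0"
      by (rule Lim_null_comparison)
    then show ?case by (simp add: LIM_zero_iff)
  qed
  have norm_lim: "(\<lambda>k. \<integral>\<^sup>+x. ennreal (norm (indicator E x *\<^sub>R g x - s E k x)) \<partial>N) \<longlonglongrightarrow> 0" for E
  proof -
    have le: "(\<integral>\<^sup>+x. ennreal (norm (indicator E x *\<^sub>R g x - s E k x)) \<partial>N)
        \<le> ennreal ((1/2) ^ k * (measure N (space N) + 1))" for k
    proof -
      \<comment> \<open>a measurable majorant: the approximation error on the kept pieces, plus the discarded vectors\<close>
      define h where "h = (\<lambda>x. ennreal ((1/2) ^ k) +
        (\<Sum>j. ennreal (norm (y k (j + m k))) * indicator (C k (j + m k)) x))"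
      have "(\<integral>\<^sup>+x. ennreal (norm (indicator E x *\<^sub>R g x - s E k x)) \<partial>N) \<le> (\<integral>\<^sup>+x. h x \<partial>N)"
      proof (rule nn_integral_mono_AE)
        show "AE x in N. ennreal (norm (indicator E x *\<^sub>R g x - s E k x)) \<le> h x"
          using AE1 AEg
        proof eventually_elim
          case (elim x)
          obtain i where i: "x \<in> C k i" using elim(1) by auto
          have gi: "norm (g x - y k i) \<le> (1/2) ^ k" using elim(2) i by auto
          show ?case
          proof (cases "i < m k")
            case True
            then have "norm (indicator E x *\<^sub>R g x - s E k x) \<le> (1/2) ^ k"
              using s_eq[OF i, of E] gi by (auto simp: indicator_def)
            then have "ennreal (norm (indicator E x *\<^sub>R g x - s E k x)) \<le> ennreal ((1/2) ^ k)"
              by (rule ennreal_leI)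
            then show ?thesis unfolding h_def by (rule order_trans) simp
          next
            case False
            have df: "disjoint_family (\<lambda>j. C k (j + m k))"
              using C(3)[of k] by (auto simp: disjoint_family_on_def)
            have "(\<Sum>j. ennreal (norm (y k (j + m k))) * indicator (C k (j + m k)) x)
                = ennreal (norm (y k (i - m k + m k)))"
              by (rule suminf_cmult_indicator[OF df]) (use i False in simp)
            then have h: "h x = ennreal ((1/2) ^ k + norm (y k i))"
              using False by (simp add: h_def)
            have "norm (g x) \<le> norm (g x - y k i) + norm (y k i)"
              using norm_triangle_ineq[of "g x - y k i" "y k i"] by simp
            then have "norm (indicator E x *\<^sub>R g x - s E k x) \<le> (1/2) ^ k + norm (y k i)"
              using s_eq[OF i, of E] gi False by (auto simp: indicator_def)
            then show ?thesis unfolding h by (rule ennreal_leI)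
          qed
        qed
      qed
      also have "(\<integral>\<^sup>+x. h x \<partial>N) = ennreal ((1/2) ^ k) * emeasure N (space N) +
          (\<Sum>j. ennreal (norm (y k (j + m k))) * emeasure N (C k (j + m k)))"
        unfolding h_def using C(1)
        by (subst nn_integral_add, simp, measurable)
           (auto simp: nn_integral_suminf nn_integral_cmult_indicator)
      also have "\<dots> = ennreal ((1/2) ^ k * measure N (space N)) +
          (\<Sum>j. ennreal (norm (y k (j + m k)) * measure N (C k (j + m k))))"
        by (simp add: emeasure_eq_measure ennreal_mult)
      also have "(\<Sum>j. ennreal (norm (y k (j + m k)) * measure N (C k (j + m k))))
          = ennreal (\<Sum>j. norm (y k (j + m k)) * measure N (C k (j + m k)))"
        using summable_ignore_initial_segment[OF summ] by (intro suminf_ennreal2) auto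
      also have "ennreal ((1/2) ^ k * measure N (space N)) + \<dots>
          \<le> ennreal ((1/2) ^ k * measure N (space N)) + ennreal ((1/2) ^ k)"
        using m(2) by (intro add_left_mono ennreal_leI)
      also have "\<dots> = ennreal ((1/2) ^ k * (measure N (space N) + 1))"
        by (subst ennreal_plus[symmetric]) (auto simp: algebra_simps)
      finally show ?thesis .
    qed
    have "(\<lambda>k. (1/2) ^ k * (measure N (space N) + 1)) \<longlonglongrightarrow> 0 * (measure N (space N) + 1)"
      by (intro tendsto_intros LIMSEQ_power_zero) auto
    then have "(\<lambda>k. ennreal ((1/2) ^ k * (measure N (space N) + 1))) \<longlonglongrightarrow> ennreal 0"
      by (intro tendsto_ennrealI) simp
    then have lim0: "(\<lambda>k. ennreal ((1/2) ^ k * (measure N (space N) + 1))) \<longlonglongrightarrow> 0" by simp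
    show ?thesis
      by (rule tendsto_sandwich[OF _ _ tendsto_const lim0]) (intro always_eventually allI zero_le le)+
  qed
  have int_lim: "(\<lambda>k. \<Sum>i<m k. measure N (E \<inter> C k i) *\<^sub>R y k i) \<longlonglongrightarrow> G E" if E: "E \<in> sets N" for E
  proof -
    \<comment> \<open>continuity of \<open>G\<close> disposes of the discarded pieces\<close>
    have rest: "(\<lambda>k. G (E \<inter> R k (m k))) \<longlonglongrightarrow> 0"
    proof (rule LIMSEQ_I)
      fix e :: real assume "e > 0"
      then obtain d where d: "d > 0" "\<And>B. B \<in> sets N \<Longrightarrow> measure N B < d \<Longrightarrow> norm (G B) < e"
        using continuous[unfolded measure_continuous_def, rule_format, OF \<open>e > 0\<close>] by blast
      obtain K where K: "(1/2) ^ K < d" using real_arch_pow_inv[of d "1/2"] d by auto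
      have "norm (G (E \<inter> R k (m k)) - 0) < e" if "k \<ge> K" for k
      proof -
        have "measure N (E \<inter> R k (m k)) \<le> measure N (R k (m k))"
          using E R_sets by (intro finite_measure_mono) auto
        also have "\<dots> \<le> (1/2) ^ k" by (rule m)
        also have "\<dots> \<le> (1/2) ^ K" using that by (intro power_decreasing) auto
        finally show ?thesis using d(2)[of "E \<inter> R k (m k)"] K E R_sets by auto
      qed
      then show "\<exists>no. \<forall>n\<ge>no. norm (G (E \<inter> R n (m n)) - 0) < e" by blast
    qed
    have bound: "norm ((\<Sum>i<m k. measure N (E \<inter> C k i) *\<^sub>R y k i) - (G E - G (E \<inter> R k (m k))))
        \<le> (1/2) ^ k * measure N (space N)" for k
    proof -
      have df: "disjoint_family_on (\<lambda>i. E \<inter> C k i) {..<m k}"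
        using C(3)[of k] by (auto simp: disjoint_family_on_def)
      have "G E = G ((\<Union>i<m k. E \<inter> C k i) \<union> E \<inter> R k (m k))"
        using sets.sets_into_space[OF E] by (intro arg_cong[of _ _ G]) (auto simp: R_def)
      also have "\<dots> = G (\<Union>i<m k. E \<inter> C k i) + G (E \<inter> R k (m k))"
        using C E R_sets by (intro G_Un) (auto simp: R_def)
      also have "G (\<Union>i<m k. E \<inter> C k i) = (\<Sum>i<m k. G (E \<inter> C k i))"
        using C E df by (intro G_UN) auto
      finally have "norm ((\<Sum>i<m k. measure N (E \<inter> C k i) *\<^sub>R y k i) - (G E - G (E \<inter> R k (m k))))
          = norm (\<Sum>i<m k. G (E \<inter> C k i) - measure N (E \<inter> C k i) *\<^sub>R y k i)"
        by (simp add: sum_subtractf norm_minus_commute)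
      also have "\<dots> \<le> (\<Sum>i<m k. (1/2) ^ k * measure N (E \<inter> C k i))"
        using C E by (intro sum_norm_le small) auto
      also have "\<dots> \<le> (\<Sum>i<m k. (1/2) ^ k * measure N (C k i))"
        using C by (intro sum_mono mult_left_mono finite_measure_mono) auto
      also have "\<dots> \<le> (1/2) ^ k * measure N (space N)"
        unfolding sum_distrib_left[symmetric] by (intro mult_left_mono sum_le) auto
      finally show ?thesis .
    qed
    have "(\<lambda>k. (1/2) ^ k * measure N (space N)) \<longlonglongrightarrow> 0 * measure N (space N)"
      by (intro tendsto_intros LIMSEQ_power_zero) auto
    then have "(\<lambda>k. (\<Sum>i<m k. measure N (E \<inter> C k i) *\<^sub>R y k i) - (G E - G (E \<inter> R k (m k)))) \<longlonglongrightarrow> 0"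
      using Lim_null_comparison[OF always_eventually[OF allI[OF bound]]] by simp
    from tendsto_add[OF this tendsto_diff[OF tendsto_const rest, of "G E"]] show ?thesis by simp
  qed
  have sm: "simple_function N (s E k)" if "E \<in> sets N" for E k
    using s_simple(1)[OF that, of k] by (auto elim: simple_bochner_integrable.cases)
  have hb: "has_bochner N (\<lambda>x. indicator E x *\<^sub>R g x) (G E)" if E: "E \<in> sets N" for E
    unfolding has_bochner_def strongly_measurable_def
  proof (intro conjI exI[of _ "s E"] allI)
    show "(\<lambda>i. Bochner_Integration.simple_bochner_integral N (s E i)) \<longlonglongrightarrow> G E"
      using int_lim[OF E] s_simple(2)[OF E] by simp
  qed (use sm s_simple lim norm_lim E in auto)
  have "has_bochner N g (G (space N))"
  proof -
    have *: "AE x in N. (\<lambda>i. s (space N) i x) \<longlonglongrightarrow> g x"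
      using lim[of "space N"] AE_space by eventually_elim simp
    have **: "(\<integral>\<^sup>+x. ennreal (norm (g x - s (space N) k x)) \<partial>N)
        = (\<integral>\<^sup>+x. ennreal (norm (indicator (space N) x *\<^sub>R g x - s (space N) k x)) \<partial>N)" for k
      by (intro nn_integral_cong) simp
    show ?thesis
      unfolding has_bochner_def strongly_measurable_def
    proof (intro conjI exI[of _ "s (space N)"] allI)
      show "(\<lambda>i. Bochner_Integration.simple_bochner_integral N (s (space N) i)) \<longlonglongrightarrow> G (space N)"
        using int_lim[of "space N"] s_simple(2)[of "space N"] by simp
      show "(\<lambda>k. \<integral>\<^sup>+x. ennreal (norm (g x - s (space N) k x)) \<partial>N) \<longlonglongrightarrow> 0"
        unfolding ** by (rule norm_lim)
    qed (use sm s_simple * in auto)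
  qed
  then show ?thesis using hb unfolding bochner_integrable_def by blast
qed

text \<open>
  The last clause, obtained by shrinking the set once more with \<open>y = 0\<close>, makes the average over
  \<open>A\<close> itself larger than \<open>\<epsilon>\<close>.  It later bounds the norm of the operator from below.
\<close>

lemma oscillating_set_of_no_density:
  assumes V: "bounded_variation N G"
    and no: "\<not> (\<exists>g. bochner_integrable N g \<and>
      (\<forall>E\<in>sets N. has_bochner N (\<lambda>x. indicator E x *\<^sub>R g x) (G E)))"
  obtains A K \<epsilon> where "A \<in> sets N" "measure N A > 0" "K > 0" "\<epsilon> > 0"
    "\<And>C. C \<in> sets N \<Longrightarrow> C \<subseteq> A \<Longrightarrow> norm (G C) \<le> K * measure N C"
    "\<And>B y. B \<in> sets N \<Longrightarrow> B \<subseteq> A \<Longrightarrow> measure N B > 0 \<Longrightarrow>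
      \<exists>C\<in>sets N. C \<subseteq> B \<and> norm (G C - measure N C *\<^sub>R y) > \<epsilon> * measure N C"
    "norm (G A) > \<epsilon> * measure N A"
proof -
  obtain \<epsilon> D where D: "\<epsilon> > 0" "D \<in> sets N" "measure N D > 0"
    and osc: "\<And>C y. C \<in> sets N \<Longrightarrow> C \<subseteq> D \<Longrightarrow> measure N C > 0 \<Longrightarrow>
        \<exists>B\<in>sets N. B \<subseteq> C \<and> norm (G B - measure N B *\<^sub>R y) > \<epsilon> * measure N B"
  proof (rule ccontr, goal_cases)
    case 1
    note that_osc = 1(1) and \<open>\<not> thesis\<close>
    have "\<exists>C\<in>sets N. C \<subseteq> D \<and> measure N C > 0 \<and>
        (\<exists>y. \<forall>B\<in>sets N. B \<subseteq> C \<longrightarrow> norm (G B - measure N B *\<^sub>R y) \<le> \<epsilon> * measure N B)"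
      if D: "\<epsilon> > 0" "D \<in> sets N" "measure N D > 0" for \<epsilon> D
    proof (rule ccontr)
      assume none: "\<not> ?thesis"
      have "\<exists>B\<in>sets N. B \<subseteq> C \<and> norm (G B - measure N B *\<^sub>R y) > \<epsilon> * measure N B"
        if "C \<in> sets N" "C \<subseteq> D" "measure N C > 0" for C y
        using none that by (metis not_le)
      with D have thesis by (rule that_osc)
      then show False using \<open>\<not> thesis\<close> by contradiction
    qed
    from density_of_small_oscillation[OF V this] show False using no by contradiction
  qed
  obtain B K where B: "B \<in> sets N" "B \<subseteq> D" "measure N B > 0" "K > 0"
    "\<And>C. C \<in> sets N \<Longrightarrow> C \<subseteq> B \<Longrightarrow> norm (G C) \<le> K * measure N C"
    using locally_lipschitz[OF V D(2,3)] by metis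
  obtain A where A: "A \<in> sets N" "A \<subseteq> B" "norm (G A) > \<epsilon> * measure N A"
    using osc[of B 0] B by auto
  have "measure N A > 0"
    using G_null[OF A(1)] A(3) by (cases "measure N A = 0") (auto simp: zero_less_measure_iff)
  moreover have "A \<subseteq> D" using A B by auto
  ultimately show ?thesis
    using A B D osc by (intro that[of A K \<epsilon>]) auto
qed

end

section \<open>Trees of vectors with large oscillation\<close>

text \<open>
  Nodes are lists of child indices with the most recent index at the head: the children of \<open>s\<close> are
  the lists \<open>i # s\<close> with \<open>i < k s\<close>.  Level \<open>n\<close> of the tree is \<open>descendants k n []\<close>.
\<close>

primrec descendants :: "(nat list \<Rightarrow> nat) \<Rightarrow> nat \<Rightarrow> nat list \<Rightarrow> nat list set" where
  "descendants k 0 s = {s}"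
| "descendants k (Suc j) s = (\<Union>i<k s. descendants k j (i # s))"

lemma finite_descendants [simp]: "finite (descendants k j s)"
  by (induction j arbitrary: s) auto

lemma descendantsD:
  "t \<in> descendants k j s \<Longrightarrow> length t = length s + j"
  "t \<in> descendants k j s \<Longrightarrow> drop j t = s"
proof (induction j arbitrary: s)
  case (Suc j)
  { case 1 then show ?case using Suc by fastforce }
  { case 2
    then obtain i where "t \<in> descendants k j (i # s)" by auto
    then have "drop j t = i # s" by (rule Suc)
    then show ?case by (metis drop_Suc list.sel(3) drop_tl tl_drop) }
qed auto

lemma sum_descendants_Suc:
  "(\<Sum>t\<in>descendants k (Suc j) s. F t) = (\<Sum>i<k s. \<Sum>t\<in>descendants k j (i # s). F t)"
proof -
  have "descendants k j (i # s) \<inter> descendants k j (i' # s) = {}" if "i \<noteq> i'" for i i'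
    using that by (auto dest!: descendantsD(2))
  then show ?thesis by (simp add: sum.UNION_disjoint)
qed

lemma sum_descendants_add:
  "(\<Sum>t\<in>descendants k (i + j) s. F t) = (\<Sum>t\<in>descendants k i s. \<Sum>u\<in>descendants k j t. F u)"
proof (induction i arbitrary: s)
  case (Suc i)
  then show ?case by (simp only: add_Suc sum_descendants_Suc)
qed simp

lemma sum_descendants_additive:
  assumes "\<And>s. (\<Sum>i<k s. \<Phi> (i # s)) = \<Phi> s"
  shows "(\<Sum>t\<in>descendants k j s. \<Phi> t) = \<Phi> s"
  by (induction j arbitrary: s) (simp_all add: sum_descendants_Suc assms del: descendants.simps(2))

text \<open>
  Think of \<open>m\<close> as the measure of the node sets and of \<open>e\<close> as the measure of their intersections with
  a fixed set.  Then \<open>e s / m s\<close> are the values of a bounded martingale, and the sum is the \<open>L\<^sub>1\<close>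
  distance of the conditional expectations on the levels \<open>n\<close> and \<open>n + j\<close>.  Orthogonality of
  martingale increments turns the squared \<open>L\<^sub>2\<close> distance into \<open>q (n + j) - q n\<close>, where \<open>q\<close> is increasing
  and bounded.
\<close>

lemma vanishing_oscillation:
  fixes e m :: "nat list \<Rightarrow> real"
  assumes e: "\<And>s. (\<Sum>i<k s. e (i # s)) = e s" "\<And>s. 0 \<le> e s" "\<And>s. e s \<le> m s"
    and m: "\<And>s. (\<Sum>i<k s. m (i # s)) = m s" and "\<kappa> > 0"
  obtains n0 where "\<And>n j. n \<ge> n0 \<Longrightarrow>
    (\<Sum>s\<in>descendants k n []. \<Sum>t\<in>descendants k j s. \<bar>e t - e s / m s * m t\<bar>) \<le> \<kappa>"
proof -
  have m0: "0 \<le> m s" for s using e(2,3) order_trans by blast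
  have zero: "e s = 0" if "m s = 0" for s using e(2,3)[of s] that by simp
  define v where "v = (\<lambda>s. (e s)\<^sup>2 / m s)"
  define q where "q = (\<lambda>n. \<Sum>s\<in>descendants k n []. v s)"
  have v_le: "v s \<le> m s" for s
  proof (cases "m s = 0")
    case False
    then have "m s > 0" using m0[of s] by simp
    moreover have "(e s)\<^sup>2 \<le> (m s)\<^sup>2" using e(2,3) by (intro power_mono)
    ultimately show ?thesis by (simp add: v_def divide_le_eq power2_eq_square)
  qed (simp add: v_def)
  have var: "(\<Sum>t\<in>descendants k j s. v t - 2 * (e s / m s) * e t + (e s / m s)\<^sup>2 * m t)
      = (\<Sum>t\<in>descendants k j s. v t) - v s" for j s
  proof -
    have "(\<Sum>t\<in>descendants k j s. v t - 2 * (e s / m s) * e t + (e s / m s)\<^sup>2 * m t)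
        = (\<Sum>t\<in>descendants k j s. v t) - 2 * (e s / m s) * e s + (e s / m s)\<^sup>2 * m s"
      unfolding sum.distrib sum_subtractf sum_distrib_left[symmetric]
      by (simp add: sum_descendants_additive e m)
    also have "2 * (e s / m s) * e s - (e s / m s)\<^sup>2 * m s = v s"
      by (cases "m s = 0") (auto simp: v_def power2_eq_square field_simps)
    ultimately show ?thesis by simp
  qed
  have sq: "v t - 2 * a * e t + a\<^sup>2 * m t = (e t / m t - a)\<^sup>2 * m t" for t a
    by (cases "m t = 0") (auto simp: v_def zero power2_eq_square field_simps)
  have v_mono: "v s \<le> (\<Sum>t\<in>descendants k j s. v t)" for s j
  proof -
    have "0 \<le> (\<Sum>t\<in>descendants k j s. v t - 2 * (e s / m s) * e t + (e s / m s)\<^sup>2 * m t)"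
      unfolding sq using m0 by (intro sum_nonneg) auto
    then show ?thesis unfolding var by simp
  qed
  have q_add: "q (n + j) = (\<Sum>s\<in>descendants k n []. \<Sum>t\<in>descendants k j s. v t)" for n j
    unfolding q_def by (rule sum_descendants_add)
  have "incseq q"
    unfolding incseq_def
  proof (intro allI impI)
    fix a b :: nat assume "a \<le> b"
    then show "q a \<le> q b" using q_add[of a "b - a"] v_mono by (auto simp: q_def intro!: sum_mono)
  qed
  moreover have "\<forall>n. q n \<le> m []"
  proof
    show "q n \<le> m []" for n
      using sum_mono[of "descendants k n []" v m] v_le sum_descendants_additive[where \<Phi> = m and k = k, OF m]
      unfolding q_def by simp
  qed
  ultimately obtain l where l: "q \<longlonglongrightarrow> l" "\<forall>n. q n \<le> l" by (rule incseq_convergent)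
  \<comment> \<open>the balance between the two terms of the inequality \<open>2 \<tau> x \<le> \<tau>\<^sup>2 + x\<^sup>2\<close>, which takes the place of
    Cauchy--Schwarz\<close>
  define \<tau> where "\<tau> = \<kappa> / (m [] + 1)"
  have \<tau>: "\<tau> > 0" "\<tau> * m [] \<le> \<kappa>"
    using \<open>\<kappa> > 0\<close> m0[of "[]"] by (auto simp: \<tau>_def divide_simps algebra_simps)
  have "l - \<kappa> * \<tau> < l" using \<open>\<kappa> > 0\<close> \<tau> by simp
  from order_tendstoD(1)[OF l(1) this]
  obtain n0 where n0: "\<And>n. n \<ge> n0 \<Longrightarrow> q n > l - \<kappa> * \<tau>"
    unfolding eventually_sequentially by blast
  have term_le: "\<bar>e t - a * m t\<bar> \<le> \<tau> / 2 * m t + (v t - 2 * a * e t + a\<^sup>2 * m t) / (2 * \<tau>)" for t a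
  proof -
    have "0 \<le> (\<bar>e t / m t - a\<bar> - \<tau>)\<^sup>2" by simp
    then have "\<bar>e t / m t - a\<bar> * (2 * \<tau>) \<le> \<tau>\<^sup>2 + (e t / m t - a)\<^sup>2"
      by (simp add: power2_diff)
    then have "\<bar>e t / m t - a\<bar> \<le> (\<tau>\<^sup>2 + (e t / m t - a)\<^sup>2) / (2 * \<tau>)"
      using \<tau> by (simp add: le_divide_eq)
    also have "\<dots> = \<tau> / 2 + (e t / m t - a)\<^sup>2 / (2 * \<tau>)"
      using \<tau> by (simp add: add_divide_distrib power2_eq_square)
    finally have "\<bar>e t / m t - a\<bar> * m t \<le> (\<tau> / 2 + (e t / m t - a)\<^sup>2 / (2 * \<tau>)) * m t"
      using m0 by (rule mult_right_mono)
    also have "\<bar>e t / m t - a\<bar> * m t = \<bar>(e t / m t - a) * m t\<bar>"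
      using m0[of t] by (simp add: abs_mult)
    also have "(e t / m t - a) * m t = e t - a * m t"
      using zero[of t] by (cases "m t = 0") (auto simp: algebra_simps)
    finally show ?thesis unfolding sq by (simp add: algebra_simps)
  qed
  show ?thesis
  proof (rule that)
    fix n j assume "n \<ge> n0"
    have "(\<Sum>s\<in>descendants k n []. \<Sum>t\<in>descendants k j s. \<bar>e t - e s / m s * m t\<bar>)
        \<le> (\<Sum>s\<in>descendants k n []. \<tau> / 2 * m s + ((\<Sum>t\<in>descendants k j s. v t) - v s) / (2 * \<tau>))"
    proof (rule sum_mono)
      fix s
      have "(\<Sum>t\<in>descendants k j s. \<bar>e t - e s / m s * m t\<bar>) \<le> (\<Sum>t\<in>descendants k j s.
          \<tau> / 2 * m t + (v t - 2 * (e s / m s) * e t + (e s / m s)\<^sup>2 * m t) / (2 * \<tau>))"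
        by (intro sum_mono term_le)
      also have "\<dots> = \<tau> / 2 * (\<Sum>t\<in>descendants k j s. m t) +
          (\<Sum>t\<in>descendants k j s. v t - 2 * (e s / m s) * e t + (e s / m s)\<^sup>2 * m t) / (2 * \<tau>)"
        by (subst sum.distrib) (simp only: sum_distrib_left sum_divide_distrib)
      finally show "(\<Sum>t\<in>descendants k j s. \<bar>e t - e s / m s * m t\<bar>)
          \<le> \<tau> / 2 * m s + ((\<Sum>t\<in>descendants k j s. v t) - v s) / (2 * \<tau>)"
        unfolding var by (simp add: sum_descendants_additive m)
    qed
    also have "\<dots> = \<tau> / 2 * (\<Sum>s\<in>descendants k n []. m s) + (q (n + j) - q n) / (2 * \<tau>)"
      unfolding q_add fun_cong[OF q_def, of n]
      by (subst sum.distrib) (simp only: sum_distrib_left sum_divide_distrib[symmetric] sum_subtractf)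
    also have "\<dots> = \<tau> / 2 * m [] + (q (n + j) - q n) / (2 * \<tau>)"
      by (simp add: sum_descendants_additive m)
    also have "\<dots> \<le> \<kappa> / 2 + \<kappa> / 2"
    proof (rule add_mono)
      show "\<tau> / 2 * m [] \<le> \<kappa> / 2" using \<tau> by simp
      have "q (n + j) - q n \<le> \<kappa> * \<tau>"
        using n0[OF \<open>n \<ge> n0\<close>] l(2)[rule_format, of "n + j"] by simp
      then show "(q (n + j) - q n) / (2 * \<tau>) \<le> \<kappa> / 2"
        using \<tau> by (simp add: divide_le_eq)
    qed
    finally show "(\<Sum>s\<in>descendants k n []. \<Sum>t\<in>descendants k j s. \<bar>e t - e s / m s * m t\<bar>) \<le> \<kappa>"
      by simp
  qed
qed

text \<open>
  The data left of the vector measure: weights and averages.  The vectors form a bounded martingale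
  all of whose jumps exceed \<open>\<epsilon>\<close>, apart from a fraction \<open>2\<^sup>-\<^sup>n\<close> of the weight at level \<open>n\<close>; this
  exception allows every node to have finitely many children.  Nodes that the branching function \<open>k\<close>
  does not reach have weight \<open>0\<close>.
\<close>

locale oscillating_tree =
  fixes k :: "nat list \<Rightarrow> nat" and w :: "nat list \<Rightarrow> real" and y :: "nat list \<Rightarrow> 'y::banach"
    and K \<epsilon> :: real
  assumes k_pos: "0 < k s"
    and w_nonneg: "0 \<le> w s"
    and w_outside: "k s \<le> i \<Longrightarrow> w (i # s) = 0"
    and w_additive: "(\<Sum>i<k s. w (i # s)) = w s"
    and y_average: "(\<Sum>i<k s. w (i # s) *\<^sub>R y (i # s)) = w s *\<^sub>R y s"
    and y_bound: "norm (y s) \<le> K"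
    and few_small_jumps:
      "(\<Sum>i | i < k s \<and> norm (y (i # s) - y s) \<le> \<epsilon>. w (i # s)) \<le> (1/2) ^ length s * w s"

context continuous_vector_measure
begin

definition average :: "'w set \<Rightarrow> 'y" where
  "average B = (1 / measure N B) *\<^sub>R G B"

lemma measure_average: "B \<in> sets N \<Longrightarrow> measure N B *\<^sub>R average B = G B"
  using G_null[of B] by (cases "measure N B = 0") (auto simp: average_def)

text \<open>
  Exhaust \<open>B\<close> by sets whose average is far from that of \<open>B\<close>, keep finitely many of them, and let the
  remainder, of small measure, be one more piece.
\<close>

lemma oscillating_partition:
  assumes osc: "\<And>D. D \<in> sets N \<Longrightarrow> D \<subseteq> B \<Longrightarrow> measure N D > 0 \<Longrightarrow>
      \<exists>C\<in>sets N. C \<subseteq> D \<and> norm (G C - measure N C *\<^sub>R average B) > \<epsilon> * measure N C"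
    and B: "B \<in> sets N" and "\<eta> > 0"
  shows "\<exists>(k::nat) C. 0 < k \<and> (\<forall>i. C i \<in> sets N \<and> C i \<subseteq> B) \<and> (\<forall>i\<ge>k. C i = {}) \<and>
    disjoint_family_on C {..<k} \<and> (\<Union>i<k. C i) = B \<and>
    (\<Sum>i | i < k \<and> norm (average (C i) - average B) \<le> \<epsilon>. measure N (C i)) \<le> \<eta> * measure N B"
proof (cases "measure N B = 0")
  case True
  then show ?thesis using B
    by (intro exI[of _ 1] exI[of _ "\<lambda>i. if i = 0 then B else {}"])
       (auto simp: disjoint_family_on_def)
next
  case False
  then have "measure N B > 0" by (simp add: zero_less_measure_iff)
  obtain C where C: "\<And>i::nat. C i \<in> sets N" "\<And>i. C i \<subseteq> B"
    "\<And>i. measure N (C i) = 0 \<or> norm (average (C i) - average B) > \<epsilon>"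
    "disjoint_family C" "measure N (B - (\<Union>i. C i)) = 0"
  proof (rule exhaustion[of B "\<lambda>C. measure N C = 0 \<or> norm (average C - average B) > \<epsilon>"])
    fix D assume D: "D \<in> sets N" "D \<subseteq> B" "measure N D > 0"
    then obtain C where C: "C \<in> sets N" "C \<subseteq> D" "norm (G C - measure N C *\<^sub>R average B) > \<epsilon> * measure N C"
      using osc by blast
    have pos: "measure N C > 0"
      using G_null[of C] C by (cases "measure N C = 0") (auto simp: zero_less_measure_iff)
    have "G C - measure N C *\<^sub>R average B = measure N C *\<^sub>R (average C - average B)"
      using measure_average[OF C(1)] by (simp add: scaleR_diff_right)
    then have "measure N C * norm (average C - average B) > measure N C * \<epsilon>"
      using C(3) by (simp add: mult.commute)
    then show "\<exists>C\<in>sets N. C \<subseteq> D \<and> 0 < measure N C \<and> (measure N C = 0 \<or> \<epsilon> < norm (average C - average B))"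
      using C pos by (intro bexI[of _ C]) auto
  qed (use B in auto)
  define R where "R = (\<lambda>n. B - (\<Union>i<n. C i))"
  have R_sets: "R n \<in> sets N" for n using C B by (auto simp: R_def)
  have "(\<lambda>n. measure N (R n)) \<longlonglongrightarrow> measure N (\<Inter>n. R n)"
    using R_sets by (intro finite_Lim_measure_decseq) (auto simp: decseq_def R_def)
  also have "(\<Inter>n. R n) = B - (\<Union>i. C i)" by (auto simp: R_def)
  finally have "(\<lambda>n. measure N (R n)) \<longlonglongrightarrow> 0" using C(5) by simp
  moreover have "\<eta> * measure N B > 0" using \<open>\<eta> > 0\<close> \<open>measure N B > 0\<close> by simp
  ultimately have "eventually (\<lambda>n. measure N (R n) < \<eta> * measure N B) sequentially"
    by (rule order_tendstoD)
  then obtain n where n: "measure N (R n) < \<eta> * measure N B"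
    using eventually_happens'[OF sequentially_bot] by blast
  define D where "D = (\<lambda>i. if i < n then C i else if i = n then R n else {})"
  have D: "D i = (if i < n then C i else if i = n then R n else {})" for i by (simp add: D_def)
  have "(\<Union>i<Suc n. D i) = (\<Union>i<n. C i) \<union> R n"
    by (auto simp: D less_Suc_eq split: if_splits)
  also have "\<dots> = B" using C(2) by (auto simp: R_def)
  finally have "(\<Union>i<Suc n. D i) = B" .
  moreover have "disjoint_family_on D {..<Suc n}"
    unfolding disjoint_family_on_def
  proof (intro ballI impI)
    fix i j assume "i \<in> {..<Suc n}" "j \<in> {..<Suc n}" "i \<noteq> j"
    then show "D i \<inter> D j = {}"
      using disjoint_family_onD[OF C(4), of i j] by (auto simp: D R_def less_Suc_eq)
  qed
  moreover have "(\<Sum>i | i < Suc n \<and> norm (average (D i) - average B) \<le> \<epsilon>. measure N (D i)) \<le> \<eta> * measure N B"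
  proof -
    have "(\<Sum>i | i < Suc n \<and> norm (average (D i) - average B) \<le> \<epsilon>. measure N (D i))
        \<le> (\<Sum>i<Suc n. if i = n then measure N (R n) else 0)"
    proof (rule order_trans[OF sum_mono sum_mono2])
      show "measure N (D i) \<le> (if i = n then measure N (R n) else 0)"
        if "i \<in> {i. i < Suc n \<and> norm (average (D i) - average B) \<le> \<epsilon>}" for i
        using that C(3)[of i] by (auto simp: D split: if_splits)
    qed auto
    then show ?thesis using n by simp
  qed
  moreover have "D i \<in> sets N \<and> D i \<subseteq> B" "i \<ge> Suc n \<Longrightarrow> D i = {}" for i
    using C R_sets by (auto simp: D R_def)
  ultimately show ?thesis by (intro exI[of _ "Suc n"] exI[of _ D]) blast
qed

lemma oscillating_tree_exists:
  assumes A: "A \<in> sets N" "measure N A > 0" and "\<epsilon> > 0" "c > 0"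
    and K: "\<And>C. C \<in> sets N \<Longrightarrow> C \<subseteq> A \<Longrightarrow> norm (G C) \<le> K * measure N C" "K > 0"
    and osc: "\<And>B y. B \<in> sets N \<Longrightarrow> B \<subseteq> A \<Longrightarrow> measure N B > 0 \<Longrightarrow>
      \<exists>C\<in>sets N. C \<subseteq> B \<and> norm (G C - measure N C *\<^sub>R y) > \<epsilon> * measure N C"
    and GA: "norm (G A) > \<epsilon> * measure N A"
  obtains k w and y :: "nat list \<Rightarrow> 'y" where "oscillating_tree k w y K \<epsilon>" "w [] = c" "norm (y []) > \<epsilon>"
proof -
  define children where "children = (\<lambda>B n (k::nat) C. 0 < k \<and> (\<forall>i. C i \<in> sets N \<and> C i \<subseteq> B) \<and>
      (\<forall>i\<ge>k. C i = {}) \<and> disjoint_family_on C {..<k} \<and> (\<Union>i<k. C i) = B \<and>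
      (\<Sum>i | i < k \<and> norm (average (C i) - average B) \<le> \<epsilon>. measure N (C i)) \<le> (1/2) ^ n * measure N B)"
  have "\<exists>k C. B \<in> sets N \<longrightarrow> B \<subseteq> A \<longrightarrow> children B n k C" for B n
  proof (cases "B \<in> sets N \<and> B \<subseteq> A")
    case True
    have "\<exists>k C. children B n k C"
      unfolding children_def
    proof (rule oscillating_partition)
      show "\<exists>C\<in>sets N. C \<subseteq> D \<and> norm (G C - measure N C *\<^sub>R average B) > \<epsilon> * measure N C"
        if "D \<in> sets N" "D \<subseteq> B" "measure N D > 0" for D
        using that True by (intro osc) auto
    qed (use True in auto)
    then show ?thesis by blast
  qed auto
  then have "\<exists>kk CC. \<forall>B n. B \<in> sets N \<longrightarrow> B \<subseteq> A \<longrightarrow> children B n (kk B n) (CC B n)"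
    by metis
  then obtain kk CC where
    kC: "\<And>B n. B \<in> sets N \<Longrightarrow> B \<subseteq> A \<Longrightarrow> children B n (kk B n) (CC B n)"
    by blast
  define P where "P = rec_list A (\<lambda>i s B. CC B (length s) i)"
  define k where "k = (\<lambda>s. kk (P s) (length s))"
  have P_Nil: "P [] = A" and P_Cons: "P (i # s) = CC (P s) (length s) i" for i s
    by (simp_all add: P_def)
  have P: "P s \<in> sets N \<and> P s \<subseteq> A" for s
  proof (induction s)
    case (Cons i s)
    then have "children (P s) (length s) (kk (P s) (length s)) (CC (P s) (length s))"
      using kC by blast
    then show ?case using Cons unfolding P_Cons children_def by blast
  qed (simp add: P_Nil A)
  have ch: "children (P s) (length s) (k s) (\<lambda>i. P (i # s))" for s
    using kC[of "P s" "length s"] P[of s] unfolding k_def P_Cons by simp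
  have sumN: "(\<Sum>i<k s. measure N (P (i # s))) = measure N (P s)"
    and sumG: "(\<Sum>i<k s. G (P (i # s))) = G (P s)" for s
  proof -
    have eq: "(\<Union>i<k s. P (i # s)) = P s" and df: "disjoint_family_on (\<lambda>i. P (i # s)) {..<k s}"
      using ch[of s] by (auto simp: children_def)
    show "(\<Sum>i<k s. measure N (P (i # s))) = measure N (P s)"
      using finite_measure_finite_Union[of "{..<k s}" "\<lambda>i. P (i # s)"] df P eq by (auto simp: image_subset_iff)
    show "(\<Sum>i<k s. G (P (i # s))) = G (P s)"
      using G_UN[of "{..<k s}" "\<lambda>i. P (i # s)"] df P eq by auto
  qed
  \<comment> \<open>rescaling the weights leaves the averages unchanged\<close>
  define r where "r = c / measure N A"
  have r: "r > 0" using A \<open>c > 0\<close> by (simp add: r_def)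
  define w where "w = (\<lambda>s. r * measure N (P s))"
  define y where "y = (\<lambda>s. average (P s))"
  have wy: "w s *\<^sub>R y s = r *\<^sub>R G (P s)" for s
    using measure_average[of "P s"] P[of s] by (simp add: w_def y_def scaleR_scaleR[symmetric] del: scaleR_scaleR)
  have "oscillating_tree k w y K \<epsilon>"
  proof
    fix s
    show "0 < k s" using ch[of s] by (simp add: children_def)
    show "0 \<le> w s" using r by (simp add: w_def)
    show "w (i # s) = 0" if "k s \<le> i" for i
      using ch[of s] that by (simp add: children_def w_def)
    show "(\<Sum>i<k s. w (i # s)) = w s"
      using sumN by (simp add: w_def sum_distrib_left[symmetric])
    show "(\<Sum>i<k s. w (i # s) *\<^sub>R y (i # s)) = w s *\<^sub>R y s"
      unfolding wy using sumG by (simp add: scaleR_sum_right[symmetric])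
    show "norm (y s) \<le> K"
    proof (cases "measure N (P s) = 0")
      case True
      then show ?thesis using K(2) by (simp add: y_def average_def)
    next
      case False
      then show ?thesis using K(1)[of "P s"] P[of s]
        by (simp add: y_def average_def divide_le_eq zero_less_measure_iff)
    qed
    have "(\<Sum>i | i < k s \<and> norm (y (i # s) - y s) \<le> \<epsilon>. w (i # s)) =
        r * (\<Sum>i | i < k s \<and> norm (y (i # s) - y s) \<le> \<epsilon>. measure N (P (i # s)))"
      by (simp add: w_def sum_distrib_left)
    also have "\<dots> \<le> r * ((1/2) ^ length s * measure N (P s))"
      using ch[of s] r by (intro mult_left_mono) (auto simp: children_def y_def)
    finally show "(\<Sum>i | i < k s \<and> norm (y (i # s) - y s) \<le> \<epsilon>. w (i # s)) \<le> (1/2) ^ length s * w s"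
      by (simp add: w_def mult_ac)
  qed
  moreover have "w [] = c" using A by (simp add: w_def r_def P_Nil)
  moreover have "norm (y []) > \<epsilon>"
    using A GA by (simp add: y_def average_def P_Nil less_divide_eq)
  ultimately show ?thesis by (rule that)
qed

end

section \<open>The operator of an oscillating tree\<close>

lemma (in finite_measure) atomless_tree_partition:
  assumes E: "E \<in> sets M" "\<And>A. A \<subseteq> E \<Longrightarrow> \<not> is_atom M A"
    and k: "\<And>s. 0 < k s" and w: "\<And>s. 0 \<le> w s" "\<And>s i. k s \<le> i \<Longrightarrow> w (i # s) = 0"
      "\<And>s. (\<Sum>i<k s. w (i # s)) = w s" "w [] = measure M E"
  obtains Q :: "nat list \<Rightarrow> 'a set" where "Q [] = E" "\<And>s. Q s \<in> sets M" "\<And>s. measure M (Q s) = w s"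
    "\<And>s. disjoint_family_on (\<lambda>i. Q (i # s)) {..<k s}" "\<And>s. (\<Union>i<k s. Q (i # s)) = Q s"
proof -
  define children where "children = (\<lambda>B s C. (\<forall>i<k s. C i \<in> sets M \<and> measure M (C i) = w (i # s)) \<and>
    disjoint_family_on C {..<k s} \<and> (\<Union>i<k s. C i) = B)"
  have "\<exists>C. B \<in> sets M \<and> B \<subseteq> E \<and> measure M B = w s \<longrightarrow> children B s C" for B s
  proof (cases "B \<in> sets M \<and> B \<subseteq> E \<and> measure M B = w s")
    case True
    then have "\<exists>C. children B s C"
      unfolding children_def using w by (intro atomless_partition[OF E k]) auto
    then show ?thesis by blast
  qed auto
  then have "\<exists>CC. \<forall>B s. B \<in> sets M \<and> B \<subseteq> E \<and> measure M B = w s \<longrightarrow> children B s (CC B s)"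
    by (intro choice allI)
  then obtain CC where
    CC: "\<And>B s. B \<in> sets M \<Longrightarrow> B \<subseteq> E \<Longrightarrow> measure M B = w s \<Longrightarrow> children B s (CC B s)"
    by blast
  define Q where "Q = rec_list E (\<lambda>i s B. if i < k s then CC B s i else {})"
  have Q_Nil: "Q [] = E" and Q_Cons: "Q (i # s) = (if i < k s then CC (Q s) s i else {})" for i s
    by (simp_all add: Q_def)
  have Q: "Q s \<in> sets M \<and> Q s \<subseteq> E \<and> measure M (Q s) = w s" for s
  proof (induction s)
    case (Cons i s)
    then have ch: "children (Q s) s (CC (Q s) s)" using CC by blast
    then have "i < k s \<Longrightarrow> CC (Q s) s i \<subseteq> Q s" by (auto simp: children_def)
    then show ?case using Cons ch w(2)[of s i] by (auto simp: Q_Cons children_def)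
  qed (simp add: Q_Nil E w)
  have ch: "children (Q s) s (\<lambda>i. Q (i # s))" for s
  proof -
    have "children (Q s) s (CC (Q s) s)" using CC Q by blast
    then show ?thesis by (auto simp: children_def Q_Cons disjoint_family_on_def)
  qed
  show ?thesis
    using Q ch by (intro that[of Q]) (auto simp: Q_Nil children_def)
qed

lemma (in finite_measure) integrable_indicator_scalar:
  fixes B :: "'a set"
  assumes "B \<in> sets M"
  shows "integrable M (indicator B :: 'a \<Rightarrow> 'k::{real_normed_field, euclidean_space})"
proof -
  have "integrable M (\<lambda>x. indicator B x *\<^sub>R (1::'k))"
    using assms by (intro integrable_scaleR_left) (auto simp: integrable_indicator_iff emeasure_eq_measure)
  moreover have "(\<lambda>x. indicator B x *\<^sub>R (1::'k)) = indicator B" by (auto simp: indicator_def)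
  ultimately show ?thesis by simp
qed

text \<open>
  The real and the complex case are treated together.  What matters about the class of scalars is
  that the field is finite-dimensional, hence separable, and that its norm comes from an inner
  product, hence is strictly convex.
\<close>

locale scalar_multiplication =
  fixes sc :: "'k::{real_normed_field, euclidean_space} \<Rightarrow> 'y \<Rightarrow> 'y::banach"
  assumes banach_over: "banach_over sc"
begin

sublocale vector_space sc
  using banach_over by (simp add: banach_over_def)

lemma norm_sc: "norm (sc c x) = norm c * norm x"
  and sc_of_real: "sc (of_real r) x = r *\<^sub>R x"
  using banach_over by (auto simp: banach_over_def)

lemma sc_scaleR: "sc (r *\<^sub>R c) x = r *\<^sub>R sc c x"
  by (metis sc_of_real scale_scale scaleR_conv_of_real)

lemma sc_scaleR_right: "sc c (r *\<^sub>R x) = r *\<^sub>R sc c x"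
  by (metis sc_of_real scale_left_commute)

lemma tendsto_sc: "(f \<longlongrightarrow> l) F \<Longrightarrow> ((\<lambda>x. sc c (f x)) \<longlongrightarrow> sc c l) F"
proof -
  have "bounded_linear (sc c)"
    by (rule bounded_linear_intro[of _ "norm c"])
       (auto simp: scale_right_distrib sc_scaleR_right norm_sc mult.commute)
  then show "(f \<longlongrightarrow> l) F \<Longrightarrow> ((\<lambda>x. sc c (f x)) \<longlongrightarrow> sc c l) F"
    by (rule bounded_linear.tendsto)
qed

end

locale tree_operator =
  oscillating_tree k w y K \<epsilon> + finite_measure M + scalar_multiplication sc
  for k w and y :: "nat list \<Rightarrow> 'y::banach" and K \<epsilon> and M :: "'a measure"
    and sc :: "'k::{real_normed_field, euclidean_space} \<Rightarrow> 'y \<Rightarrow> 'y" +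
  fixes Q :: "nat list \<Rightarrow> 'a set"
  assumes Q_sets [measurable]: "Q s \<in> sets M"
    and Q_measure: "measure M (Q s) = w s"
    and Q_disjoint: "disjoint_family_on (\<lambda>i. Q (i # s)) {..<k s}"
    and Q_Union: "(\<Union>i<k s. Q (i # s)) = Q s"
begin

lemma K_nonneg: "0 \<le> K"
  using y_bound[of "[]"] norm_ge_zero order_trans by blast

lemma Q_descendants: "disjoint_family_on Q (descendants k j s) \<and> (\<Union>t\<in>descendants k j s. Q t) = Q s"
proof (induction j arbitrary: s)
  case (Suc j)
  have "Q t \<inter> Q t' = {}"
    if t: "t \<in> descendants k (Suc j) s" "t' \<in> descendants k (Suc j) s" "t \<noteq> t'" for t t'
  proof -
    obtain i i' where i: "i < k s" "t \<in> descendants k j (i # s)" "i' < k s" "t' \<in> descendants k j (i' # s)"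
      using t(1,2) unfolding descendants.simps by blast
    show ?thesis
    proof (cases "i = i'")
      case True
      then show ?thesis using i t(3) Suc[of "i # s"] by (auto simp: disjoint_family_on_def)
    next
      case False
      have "Q t \<subseteq> Q (i # s)" "Q t' \<subseteq> Q (i' # s)"
        using i Suc[of "i # s"] Suc[of "i' # s"] by auto
      then show ?thesis using disjoint_family_onD[OF Q_disjoint, of i s i'] i False by blast
    qed
  qed
  moreover have "(\<Union>t\<in>descendants k (Suc j) s. Q t) = Q s"
    using Suc Q_Union[of s] by simp
  ultimately show ?case by (auto simp: disjoint_family_on_def)
qed (simp add: disjoint_family_on_def)

lemma Q_subset: "t \<in> descendants k j s \<Longrightarrow> Q t \<subseteq> Q s"
  using Q_descendants[of j s] by blast

lemma mass_additive:
  assumes [measurable]: "E \<in> sets M"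
  shows "(\<Sum>i<k s. measure M (E \<inter> Q (i # s))) = measure M (E \<inter> Q s)"
proof -
  have "measure M (\<Union>i<k s. E \<inter> Q (i # s)) = (\<Sum>i<k s. measure M (E \<inter> Q (i # s)))"
    using Q_disjoint[of s]
    by (intro finite_measure_finite_Union) (auto simp: disjoint_family_on_def)
  moreover have "(\<Union>i<k s. E \<inter> Q (i # s)) = E \<inter> Q s" using Q_Union[of s] by blast
  ultimately show ?thesis by simp
qed

lemma mass_le: "E \<in> sets M \<Longrightarrow> measure M (E \<inter> Q s) \<le> w s"
  unfolding Q_measure[symmetric] by (intro finite_measure_mono) auto

definition approx :: "nat \<Rightarrow> ('a \<Rightarrow> 'k) \<Rightarrow> 'y" where
  "approx n f = (\<Sum>s\<in>descendants k n []. sc (LINT x:Q s|M. f x) (y s))"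

lemma set_integrable_Q: "integrable M f \<Longrightarrow> set_integrable M (Q s) f" for f :: "'a \<Rightarrow> 'k"
  unfolding set_integrable_def by (intro integrable_mult_indicator) auto

lemma approx_add:
  assumes "integrable M f" "integrable M g"
  shows "approx n (\<lambda>x. f x + g x) = approx n f + approx n g"
  using assms unfolding approx_def
  by (simp add: set_integrable_Q set_integral_add scale_left_distrib sum.distrib)

lemma approx_scale: "approx n (\<lambda>x. c * f x) = sc c (approx n f)"
  unfolding approx_def by (simp add: scale_sum_right)

lemma norm_approx_le:
  assumes f: "integrable M f"
  shows "norm (approx n f) \<le> K * (\<integral>x. norm (f x) \<partial>M)"
proof -
  have [measurable]: "f \<in> borel_measurable M" using f by simp
  have "norm (approx n f) \<le> (\<Sum>s\<in>descendants k n []. norm (LINT x:Q s|M. f x) * norm (y s))"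
    unfolding approx_def norm_sc[symmetric] by (rule norm_sum)
  also have "\<dots> \<le> (\<Sum>s\<in>descendants k n []. (\<integral>x. indicator (Q s) x * norm (f x) \<partial>M) * K)"
  proof (intro sum_mono mult_mono y_bound)
    fix s
    have "norm (LINT x:Q s|M. f x) \<le> (\<integral>x. norm (indicator (Q s) x *\<^sub>R f x) \<partial>M)"
      unfolding set_lebesgue_integral_def by (rule integral_norm_bound)
    then show "norm (LINT x:Q s|M. f x) \<le> (\<integral>x. indicator (Q s) x * norm (f x) \<partial>M)"
      by simp
    then show "0 \<le> (\<integral>x. indicator (Q s) x * norm (f x) \<partial>M)"
      by (rule order_trans[OF norm_ge_zero])
  qed auto
  also have "\<dots> = K * (\<Sum>s\<in>descendants k n []. \<integral>x. indicator (Q s) x * norm (f x) \<partial>M)"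
    by (simp add: sum_distrib_left mult.commute)
  also have "(\<Sum>s\<in>descendants k n []. \<integral>x. indicator (Q s) x * norm (f x) \<partial>M)
      = (\<integral>x. (\<Sum>s\<in>descendants k n []. indicator (Q s) x * norm (f x)) \<partial>M)"
    using f by (intro Bochner_Integration.integral_sum[symmetric])
      (auto intro!: integrable_real_mult_indicator integrable_norm simp: mult.commute)
  also have "\<dots> \<le> (\<integral>x. norm (f x) \<partial>M)"
  proof (rule integral_mono)
    show "(\<Sum>s\<in>descendants k n []. indicator (Q s) x * norm (f x)) \<le> norm (f x)" for x
    proof -
      have "(\<Sum>s\<in>descendants k n []. indicator (Q s) x :: real) = indicator (\<Union>s\<in>descendants k n []. Q s) x"
        using Q_descendants[of n "[]"] by (intro indicator_UN_disjoint[symmetric]) auto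
      also have "\<dots> \<le> 1" by simp
      finally show ?thesis
        unfolding sum_distrib_right[symmetric] by (intro mult_left_le_one_le) (auto intro!: sum_nonneg)
    qed
    show "integrable M (\<lambda>x. \<Sum>s\<in>descendants k n []. indicator (Q s) x * norm (f x))"
      using f by (intro Bochner_Integration.integrable_sum)
        (auto intro!: integrable_real_mult_indicator integrable_norm simp: mult.commute)
  qed (use f in simp)
  finally show ?thesis using K_nonneg by (simp add: mult_left_mono)
qed

lemma approx_indicator:
  assumes [measurable]: "E \<in> sets M"
  shows "approx n (\<lambda>x. indicator E x *\<^sub>R c) = sc c (\<Sum>s\<in>descendants k n []. measure M (E \<inter> Q s) *\<^sub>R y s)"
proof -
  have "(LINT x:Q s|M. indicator E x *\<^sub>R c) = measure M (E \<inter> Q s) *\<^sub>R c" for s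
  proof -
    have "(LINT x:Q s|M. indicator E x *\<^sub>R c) = (\<integral>x. indicator (E \<inter> Q s) x *\<^sub>R c \<partial>M)"
      unfolding set_lebesgue_integral_def
      by (intro Bochner_Integration.integral_cong) (auto simp: indicator_def)
    also have "\<dots> = (\<integral>x. indicator (E \<inter> Q s) x \<partial>M) *\<^sub>R c"
      by (intro integral_scaleR_left) (auto simp: integrable_indicator_iff emeasure_eq_measure)
    also have "(\<integral>x. indicator (E \<inter> Q s) x \<partial>M) = measure M (E \<inter> Q s)" by simp
    finally show ?thesis .
  qed
  then show ?thesis
    unfolding approx_def by (simp add: sc_scaleR sc_scaleR_right scale_sum_right)
qed

text \<open>
  The martingale property of \<open>y\<close> lets \<open>y s\<close> be replaced by an average over the descendants of \<open>s\<close>,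
  so that only the oscillation of the conditional expectation of \<open>1\<^sub>E\<close> remains.
\<close>

lemma level_deviation:
  assumes E: "E \<in> sets M"
  shows "(\<Sum>t\<in>descendants k j s. measure M (E \<inter> Q t) *\<^sub>R y t) - measure M (E \<inter> Q s) *\<^sub>R y s
      = (\<Sum>t\<in>descendants k j s. (measure M (E \<inter> Q t) - measure M (E \<inter> Q s) / w s * w t) *\<^sub>R y t)"
proof -
  have "(\<Sum>t\<in>descendants k j s. (measure M (E \<inter> Q s) / w s * w t) *\<^sub>R y t)
      = (measure M (E \<inter> Q s) / w s) *\<^sub>R (\<Sum>t\<in>descendants k j s. w t *\<^sub>R y t)"
    by (simp add: scaleR_sum_right)
  also have "(\<Sum>t\<in>descendants k j s. w t *\<^sub>R y t) = w s *\<^sub>R y s"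
    by (rule sum_descendants_additive[where \<Phi> = "\<lambda>t. w t *\<^sub>R y t"]) (rule y_average)
  also have "(measure M (E \<inter> Q s) / w s) *\<^sub>R (w s *\<^sub>R y s) = measure M (E \<inter> Q s) *\<^sub>R y s"
    using mass_le[OF E, of s] measure_nonneg[of M "E \<inter> Q s"] by (cases "w s = 0") auto
  finally show ?thesis by (simp add: scaleR_diff_left sum_subtractf)
qed

lemma norm_level_deviation_le:
  assumes E: "E \<in> sets M"
  shows "norm ((\<Sum>t\<in>descendants k j s. measure M (E \<inter> Q t) *\<^sub>R y t) - measure M (E \<inter> Q s) *\<^sub>R y s)
      \<le> K * (\<Sum>t\<in>descendants k j s. \<bar>measure M (E \<inter> Q t) - measure M (E \<inter> Q s) / w s * w t\<bar>)"
  unfolding level_deviation[OF E] sum_distrib_left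
  by (intro sum_norm_le) (simp add: mult_left_mono y_bound mult.commute[of K])

lemma oscillation:
  assumes E: "E \<in> sets M" and "\<kappa> > 0"
  obtains n0 where "\<And>n j. n \<ge> n0 \<Longrightarrow> (\<Sum>s\<in>descendants k n []. \<Sum>t\<in>descendants k j s.
      \<bar>measure M (E \<inter> Q t) - measure M (E \<inter> Q s) / w s * w t\<bar>) \<le> \<kappa>"
  by (rule vanishing_oscillation[where e = "\<lambda>s. measure M (E \<inter> Q s)" and m = w and k = k])
     (use mass_additive[OF E] mass_le[OF E] w_additive \<open>\<kappa> > 0\<close> in auto)

lemma convergent_level_sums:
  assumes E: "E \<in> sets M"
  shows "convergent (\<lambda>n. \<Sum>s\<in>descendants k n []. measure M (E \<inter> Q s) *\<^sub>R y s)"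
proof -
  let ?S = "\<lambda>n. \<Sum>s\<in>descendants k n []. measure M (E \<inter> Q s) *\<^sub>R y s"
  have "Cauchy ?S"
  proof (rule CauchyI')
    fix r :: real assume "r > 0"
    define \<kappa> where "\<kappa> = r / (K + 1)"
    have \<kappa>: "\<kappa> > 0" "K * \<kappa> < r" using \<open>r > 0\<close> K_nonneg by (auto simp: \<kappa>_def divide_simps)
    obtain n0 where n0: "\<And>n j. n \<ge> n0 \<Longrightarrow> (\<Sum>s\<in>descendants k n []. \<Sum>t\<in>descendants k j s.
      \<bar>measure M (E \<inter> Q t) - measure M (E \<inter> Q s) / w s * w t\<bar>) \<le> \<kappa>"
      using oscillation[OF E \<kappa>(1)] by blast
    have "norm (?S n - ?S n') < r" if "n \<ge> n0" "n' > n" for n n'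
    proof -
      define j where "j = n' - n"
      have n': "n' = n + j" using that by (simp add: j_def)
      have "norm (?S n' - ?S n) = norm (\<Sum>s\<in>descendants k n [].
          (\<Sum>t\<in>descendants k j s. measure M (E \<inter> Q t) *\<^sub>R y t) - measure M (E \<inter> Q s) *\<^sub>R y s)"
        unfolding n' by (simp add: sum_descendants_add sum_subtractf)
      also have "\<dots> \<le> (\<Sum>s\<in>descendants k n []. K * (\<Sum>t\<in>descendants k j s.
          \<bar>measure M (E \<inter> Q t) - measure M (E \<inter> Q s) / w s * w t\<bar>))"
        by (intro sum_norm_le norm_level_deviation_le E)
      also have "\<dots> \<le> K * \<kappa>"
        unfolding sum_distrib_left[symmetric] using n0[OF that(1)] K_nonneg by (intro mult_left_mono)
      finally show ?thesis using \<kappa> by (simp add: norm_minus_commute)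
    qed
    then show "\<exists>M. \<forall>m\<ge>M. \<forall>n>m. dist (?S m) (?S n) < r" by (auto simp: dist_norm)
  qed
  then show ?thesis by (rule Cauchy_convergent)
qed

text \<open>
  For indicators this is the \<open>L\<^sub>2\<close> convergence above.  It extends to all integrable functions since the
  approximations are bounded in operator norm, uniformly in \<open>n\<close>.
\<close>

lemma convergent_approx:
  assumes "integrable M f"
  shows "convergent (\<lambda>n. approx n f)"
  using assms
proof (induction f)
  case (base A c)
  obtain L where "(\<lambda>n. \<Sum>s\<in>descendants k n []. measure M (A \<inter> Q s) *\<^sub>R y s) \<longlonglongrightarrow> L"
    using convergent_level_sums[OF base(1)] by (auto simp: convergent_def)
  from tendsto_sc[OF this, of c] show ?case
    unfolding approx_indicator[OF base(1)] by (rule convergentI)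
next
  case (add f g)
  then show ?case by (simp add: approx_add convergent_add)
next
  case (lim f s)
  have conv: "convergent (\<lambda>n. approx n (s i))" for i by fact
  have dom: "norm (s i x) \<le> 2 * norm (f x)" if "x \<in> space M" for i x using lim that by blast
  have meas [measurable]: "f \<in> borel_measurable M" "\<And>i. s i \<in> borel_measurable M" using lim by simp_all
  have "(\<lambda>i. \<integral>x. norm (s i x - f x) \<partial>M) \<longlonglongrightarrow> (\<integral>x. 0 \<partial>M)"
  proof (rule integral_dominated_convergence[where w = "\<lambda>x. 3 * norm (f x)"])
    show "AE x in M. (\<lambda>i. norm (s i x - f x)) \<longlonglongrightarrow> 0"
    proof (intro AE_I2)
      fix x assume "x \<in> space M"
      then have "(\<lambda>i. s i x - f x) \<longlonglongrightarrow> f x - f x" using lim by (intro tendsto_intros)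
      then show "(\<lambda>i. norm (s i x - f x)) \<longlonglongrightarrow> 0" by (simp add: tendsto_norm_zero)
    qed
    show "AE x in M. norm (norm (s i x - f x)) \<le> 3 * norm (f x)" for i
    proof (intro AE_I2)
      fix x assume "x \<in> space M"
      then show "norm (norm (s i x - f x)) \<le> 3 * norm (f x)"
        using dom[of x i] norm_triangle_ineq4[of "s i x" "f x"] by simp
    qed
  qed (use lim in auto)
  then have L1: "(\<lambda>i. \<integral>x. norm (s i x - f x) \<partial>M) \<longlonglongrightarrow> 0" by simp
  have "Cauchy (\<lambda>n. approx n f)"
  proof (rule CauchyI')
    fix r :: real assume "r > 0"
    then have "r / (3 * (K + 1)) > 0" using K_nonneg by simp
    then obtain i where i: "(\<integral>x. norm (s i x - f x) \<partial>M) < r / (3 * (K + 1))"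
      using order_tendstoD(2)[OF L1] eventually_happens'[OF sequentially_bot] by blast
    have near: "norm (approx n (s i) - approx n f) < r / 3" for n
    proof -
      have "approx n (s i) = approx n f + approx n (\<lambda>x. s i x - f x)"
        using approx_add[of f "\<lambda>x. s i x - f x" n] lim by simp
      then have "norm (approx n (s i) - approx n f) \<le> K * (\<integral>x. norm (s i x - f x) \<partial>M)"
        using norm_approx_le[of "\<lambda>x. s i x - f x" n] lim by simp
      also have "\<dots> \<le> K * (r / (3 * (K + 1)))" using i K_nonneg by (intro mult_left_mono) auto
      also have "\<dots> < r / 3" using K_nonneg \<open>r > 0\<close> by (simp add: divide_simps)
      finally show ?thesis .
    qed
    obtain n0 where n0: "\<And>m n. m \<ge> n0 \<Longrightarrow> n \<ge> n0 \<Longrightarrow> norm (approx m (s i) - approx n (s i)) < r / 3"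
      using CauchyD[OF convergent_Cauchy[OF conv[of i]], of "r / 3"] \<open>r > 0\<close>
      by (meson zero_less_divide_iff zero_less_numeral)
    have "dist (approx m f) (approx n f) < r" if "m \<ge> n0" "n > m" for m n
    proof -
      have "norm (approx m f - approx n f) = norm ((approx m (s i) - approx n (s i))
          - (approx m (s i) - approx m f) + (approx n (s i) - approx n f))" by simp
      also have "\<dots> \<le> norm (approx m (s i) - approx n (s i))
          + norm (approx m (s i) - approx m f) + norm (approx n (s i) - approx n f)"
        by (intro order_trans[OF norm_triangle_ineq] add_right_mono norm_triangle_ineq4)
      also have "\<dots> < r" using near[of m] near[of n] n0[of m n] that by simp
      finally show ?thesis by (simp add: dist_norm)
    qed
    then show "\<exists>M. \<forall>m\<ge>M. \<forall>n>m. dist (approx m f) (approx n f) < r" by blast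
  qed
  then show ?case by (rule Cauchy_convergent)
qed

definition limit_operator :: "('a \<Rightarrow> 'k) \<Rightarrow> 'y" where
  "limit_operator f = lim (\<lambda>n. approx n f)"

lemma approx_tendsto: "integrable M f \<Longrightarrow> (\<lambda>n. approx n f) \<longlonglongrightarrow> limit_operator f"
  using convergent_approx unfolding limit_operator_def by (simp add: convergent_LIMSEQ_iff)

lemma limit_operator_add:
  "integrable M f \<Longrightarrow> integrable M g \<Longrightarrow>
    limit_operator (\<lambda>x. f x + g x) = limit_operator f + limit_operator g"
  using tendsto_add[OF approx_tendsto approx_tendsto, of f g]
  unfolding limit_operator_def[of "\<lambda>x. f x + g x"] by (simp add: approx_add limI)

lemma limit_operator_scale:
  "integrable M f \<Longrightarrow> limit_operator (\<lambda>x. c * f x) = sc c (limit_operator f)"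
  using tendsto_sc[OF approx_tendsto, of f c]
  unfolding limit_operator_def[of "\<lambda>x. c * f x"] by (simp add: approx_scale limI)

lemma norm_limit_operator_le:
  "integrable M f \<Longrightarrow> norm (limit_operator f) \<le> K * (\<integral>x. norm (f x) \<partial>M)"
  using norm_approx_le by (intro LIMSEQ_le_const2[OF tendsto_norm[OF approx_tendsto]]) auto

lemma limit_operator_AE:
  assumes "integrable M f" "integrable M g" "AE x in M. f x = g x"
  shows "limit_operator f = limit_operator g"
proof -
  have "AE x in M. indicator (Q s) x *\<^sub>R f x = indicator (Q s) x *\<^sub>R g x" for s
    using assms(3) by eventually_elim simp
  then have "(LINT x:Q s|M. f x) = (LINT x:Q s|M. g x)" for s
    unfolding set_lebesgue_integral_def using assms
    by (intro integral_cong_AE) auto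
  then show ?thesis by (simp add: limit_operator_def approx_def)
qed

lemma limit_operator_outside:
  assumes "\<And>x. x \<in> Q [] \<Longrightarrow> f x = 0"
  shows "limit_operator f = 0"
proof -
  have "(LINT x:Q s|M. f x) = 0" if "s \<in> descendants k n []" for n s
  proof -
    have "indicator (Q s) x *\<^sub>R f x = 0" for x
      using Q_subset[OF that] assms by (auto simp: indicator_def)
    then show ?thesis unfolding set_lebesgue_integral_def by (simp only: Bochner_Integration.integral_zero)
  qed
  then have "approx n f = 0" for n by (simp add: approx_def)
  then show ?thesis by (simp add: limit_operator_def)
qed

lemma limit_operator_indicator:
  assumes "E \<in> sets M"
  shows "(\<lambda>n. \<Sum>s\<in>descendants k n []. measure M (E \<inter> Q s) *\<^sub>R y s) \<longlonglongrightarrow> limit_operator (indicator E)"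
proof -
  have "indicator E = (\<lambda>x. indicator E x *\<^sub>R (1::'k))" by (auto simp: indicator_def)
  moreover have "integrable M (indicator E :: 'a \<Rightarrow> 'k)"
    using assms by (rule integrable_indicator_scalar)
  ultimately show ?thesis
    using approx_tendsto[of "indicator E"] approx_indicator[OF assms, of _ 1] by simp
qed

lemma limit_operator_root: "limit_operator (indicator (Q [])) = w [] *\<^sub>R y []"
proof -
  have "(\<Sum>s\<in>descendants k n []. measure M (Q [] \<inter> Q s) *\<^sub>R y s) = w [] *\<^sub>R y []" for n
  proof -
    have "(\<Sum>s\<in>descendants k n []. measure M (Q [] \<inter> Q s) *\<^sub>R y s) = (\<Sum>s\<in>descendants k n []. w s *\<^sub>R y s)"
      using Q_subset by (intro sum.cong) (auto simp: Q_measure inf_absorb2)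
    also have "\<dots> = w [] *\<^sub>R y []"
      by (rule sum_descendants_additive[where \<Phi> = "\<lambda>t. w t *\<^sub>R y t"]) (rule y_average)
    finally show ?thesis .
  qed
  then show ?thesis
    using limit_operator_indicator[of "Q []"] by (simp add: LIMSEQ_const_iff)
qed

text \<open>
  Testing the assumption with \<open>B = E \<inter> Q s\<close> compares \<open>y s\<close> with \<open>z\<close>: the value of the operator at the
  indicator of this set is nearly \<open>\<mu>(E \<inter> Q s) y s\<close>, with an error that the oscillation of \<open>1\<^sub>E\<close>
  beyond level \<open>n\<close> controls.  The errors are summed over the level, because \<open>E\<close> need not belong to the
  \<open>\<sigma>\<close>-algebra generated by the sets \<open>Q s\<close> and no single node has to be almost filled by \<open>E\<close>.
\<close>

lemma level_sum_near_rank_one: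
  assumes E: "E \<in> sets M" and "0 \<le> \<delta>" "\<kappa> > 0"
    and near: "\<And>B. B \<in> sets M \<Longrightarrow> B \<subseteq> E \<Longrightarrow>
      norm (limit_operator (indicator B) - measure M B *\<^sub>R z) \<le> \<delta> * measure M B"
  obtains n0 where "\<And>n. n \<ge> n0 \<Longrightarrow> (\<Sum>s\<in>descendants k n []. measure M (E \<inter> Q s) * norm (y s - z))
      \<le> \<delta> * measure M (E \<inter> Q []) + K * \<kappa>"
proof -
  let ?e = "\<lambda>s. measure M (E \<inter> Q s)"
  obtain n0 where n0: "\<And>n j. n \<ge> n0 \<Longrightarrow> (\<Sum>s\<in>descendants k n []. \<Sum>t\<in>descendants k j s.
      \<bar>?e t - ?e s / w s * w t\<bar>) \<le> \<kappa>"
    using oscillation[OF E \<open>\<kappa> > 0\<close>] by blast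
  have "(\<Sum>s\<in>descendants k n []. ?e s * norm (y s - z)) \<le> \<delta> * ?e [] + K * \<kappa>" if n: "n \<ge> n0" for n
  proof -
    let ?L = "\<lambda>s. limit_operator (indicator (E \<inter> Q s))"
    have lim: "(\<lambda>j. \<Sum>t\<in>descendants k j s. ?e t *\<^sub>R y t) \<longlonglongrightarrow> ?L s" if s: "s \<in> descendants k n []" for s
    proof -
      have "(\<Sum>t\<in>descendants k (n + j) []. measure M (E \<inter> Q s \<inter> Q t) *\<^sub>R y t)
          = (\<Sum>t\<in>descendants k j s. ?e t *\<^sub>R y t)" for j
      proof -
        have "(\<Sum>t\<in>descendants k j s'. measure M (E \<inter> Q s \<inter> Q t) *\<^sub>R y t)
            = (if s' = s then \<Sum>t\<in>descendants k j s. ?e t *\<^sub>R y t else 0)"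
          if s': "s' \<in> descendants k n []" for s'
        proof (cases "s' = s")
          case True
          have "E \<inter> Q s \<inter> Q t = E \<inter> Q t" if "t \<in> descendants k j s" for t
            using Q_subset[OF that] by blast
          then show ?thesis using True by simp
        next
          case False
          have "Q s \<inter> Q s' = {}"
            using Q_descendants[of n "[]"] s s' False by (auto simp: disjoint_family_on_def)
          then have "E \<inter> Q s \<inter> Q t = {}" if "t \<in> descendants k j s'" for t
            using Q_subset[OF that] by blast
          then show ?thesis using False by simp
        qed
        then show ?thesis using s by (simp add: sum_descendants_add)
      qed
      moreover have "(\<lambda>j. \<Sum>t\<in>descendants k (n + j) []. measure M (E \<inter> Q s \<inter> Q t) *\<^sub>R y t) \<longlonglongrightarrow> ?L s"
        using LIMSEQ_ignore_initial_segment[OF limit_operator_indicator[of "E \<inter> Q s"], of n] E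
        by (simp add: add.commute)
      ultimately show ?thesis by simp
    qed
    have "(\<Sum>s\<in>descendants k n []. norm (?L s - ?e s *\<^sub>R y s)) \<le> K * \<kappa>"
    proof (rule LIMSEQ_le_const2)
      show "(\<lambda>j. \<Sum>s\<in>descendants k n []. norm ((\<Sum>t\<in>descendants k j s. ?e t *\<^sub>R y t) - ?e s *\<^sub>R y s))
          \<longlonglongrightarrow> (\<Sum>s\<in>descendants k n []. norm (?L s - ?e s *\<^sub>R y s))"
        by (intro tendsto_sum tendsto_norm tendsto_diff lim tendsto_const)
      have "(\<Sum>s\<in>descendants k n []. norm ((\<Sum>t\<in>descendants k j s. ?e t *\<^sub>R y t) - ?e s *\<^sub>R y s)) \<le> K * \<kappa>" for j
      proof -
        have "(\<Sum>s\<in>descendants k n []. norm ((\<Sum>t\<in>descendants k j s. ?e t *\<^sub>R y t) - ?e s *\<^sub>R y s))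
            \<le> (\<Sum>s\<in>descendants k n []. K * (\<Sum>t\<in>descendants k j s. \<bar>?e t - ?e s / w s * w t\<bar>))"
          by (intro sum_mono norm_level_deviation_le E)
        also have "\<dots> \<le> K * \<kappa>"
          unfolding sum_distrib_left[symmetric] using n0[OF n] K_nonneg by (intro mult_left_mono)
        finally show ?thesis .
      qed
      then show "\<exists>N. \<forall>j\<ge>N. (\<Sum>s\<in>descendants k n []. norm ((\<Sum>t\<in>descendants k j s. ?e t *\<^sub>R y t) - ?e s *\<^sub>R y s)) \<le> K * \<kappa>"
        by blast
    qed
    moreover have "(\<Sum>s\<in>descendants k n []. norm (?L s - ?e s *\<^sub>R z)) \<le> (\<Sum>s\<in>descendants k n []. \<delta> * ?e s)"
      using E by (intro sum_mono near) auto
    moreover have "(\<Sum>s\<in>descendants k n []. \<delta> * ?e s) = \<delta> * ?e []"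
      unfolding sum_distrib_left[symmetric]
      by (simp add: sum_descendants_additive[where \<Phi> = ?e] mass_additive[OF E])
    moreover have "(\<Sum>s\<in>descendants k n []. ?e s * norm (y s - z))
        \<le> (\<Sum>s\<in>descendants k n []. norm (?L s - ?e s *\<^sub>R z) + norm (?L s - ?e s *\<^sub>R y s))"
    proof (rule sum_mono)
      fix s
      have "?e s * norm (y s - z) = norm ((?L s - ?e s *\<^sub>R z) - (?L s - ?e s *\<^sub>R y s))"
        by (simp add: scaleR_diff_right[symmetric])
      also have "\<dots> \<le> norm (?L s - ?e s *\<^sub>R z) + norm (?L s - ?e s *\<^sub>R y s)"
        by (rule norm_triangle_ineq4)
      finally show "?e s * norm (y s - z) \<le> norm (?L s - ?e s *\<^sub>R z) + norm (?L s - ?e s *\<^sub>R y s)" .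
    qed
    ultimately show ?thesis by (simp add: sum.distrib)
  qed
  then show ?thesis by (rule that)
qed

text \<open>
  On two consecutive levels the vectors are within \<open>\<delta>\<close> of \<open>z\<close> on average over \<open>E\<close>, hence within
  \<open>2 \<delta>\<close> of each other, whereas most of the jumps exceed \<open>\<epsilon>\<close>.
\<close>

lemma no_rank_one_piece:
  assumes E: "E \<in> sets M" "E \<subseteq> Q []" and \<delta>: "0 \<le> \<delta>" and "0 < \<epsilon>"
    and near: "\<And>B. B \<in> sets M \<Longrightarrow> B \<subseteq> E \<Longrightarrow>
      norm (limit_operator (indicator B) - measure M B *\<^sub>R z) \<le> \<delta> * measure M B"
  shows "\<epsilon> * measure M E \<le> 2 * \<delta> * measure M E"
proof -
  let ?e = "\<lambda>s. measure M (E \<inter> Q s)"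
  have eE: "?e [] = measure M E" using E by (simp add: inf_absorb1)
  have main: "\<epsilon> * measure M E \<le> 2 * \<delta> * measure M E + 2 * (K * \<kappa>)" if \<kappa>: "\<kappa> > 0" for \<kappa>
  proof -
    obtain n0 where n0: "\<And>n. n \<ge> n0 \<Longrightarrow>
        (\<Sum>s\<in>descendants k n []. ?e s * norm (y s - z)) \<le> \<delta> * ?e [] + K * \<kappa>"
      using level_sum_near_rank_one[OF E(1) \<delta> \<kappa> near] by blast
    have bound: "\<epsilon> * (measure M E - (1/2) ^ n * w []) \<le> 2 * \<delta> * measure M E + 2 * (K * \<kappa>)"
      if n: "n \<ge> n0" for n
    proof -
      let ?D = "descendants k n []"
      have jump: "\<epsilon> * (?e s - (1/2) ^ n * w s) \<le> (\<Sum>i<k s. ?e (i # s) * norm (y (i # s) - y s))"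
        if s: "s \<in> ?D" for s
      proof -
        \<comment> \<open>the exceptional children carry at most the fraction \<open>2\<^sup>-\<^sup>n\<close> of the weight of \<open>s\<close>\<close>
        let ?bad = "{i. i < k s \<and> norm (y (i # s) - y s) \<le> \<epsilon>}"
        have len: "length s = n" using descendantsD(1)[OF s] by simp
        have "(\<Sum>i\<in>?bad. ?e (i # s)) \<le> (\<Sum>i\<in>?bad. w (i # s))"
          by (intro sum_mono mass_le E)
        also have "\<dots> \<le> (1/2) ^ n * w s" using few_small_jumps[of s] len by simp
        finally have bad: "(\<Sum>i\<in>?bad. ?e (i # s)) \<le> (1/2) ^ n * w s" .
        have "{..<k s} = ({..<k s} - ?bad) \<union> ?bad" by auto
        then have "?e s = (\<Sum>i\<in>{..<k s} - ?bad. ?e (i # s)) + (\<Sum>i\<in>?bad. ?e (i # s))"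
          using sum.subset_diff[of ?bad "{..<k s}" "\<lambda>i. ?e (i # s)"] mass_additive[OF E(1), of s] by auto
        then have "\<epsilon> * (?e s - (1/2) ^ n * w s) \<le> \<epsilon> * (\<Sum>i\<in>{..<k s} - ?bad. ?e (i # s))"
          using bad \<open>0 < \<epsilon>\<close> by (intro mult_left_mono) auto
        also have "\<dots> \<le> (\<Sum>i\<in>{..<k s} - ?bad. ?e (i # s) * norm (y (i # s) - y s))"
          unfolding sum_distrib_left by (intro sum_mono) (auto simp: mult.commute[of \<epsilon>] intro!: mult_left_mono)
        also have "\<dots> \<le> (\<Sum>i<k s. ?e (i # s) * norm (y (i # s) - y s))"
          by (intro sum_mono2) auto
        finally show ?thesis .
      qed
      have "\<epsilon> * (measure M E - (1/2) ^ n * w []) = \<epsilon> * ((\<Sum>s\<in>?D. ?e s) - (1/2) ^ n * (\<Sum>s\<in>?D. w s))"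
        by (simp add: sum_descendants_additive[where \<Phi> = ?e] sum_descendants_additive[where \<Phi> = w]
            mass_additive[OF E(1)] w_additive eE)
      also have "\<dots> = (\<Sum>s\<in>?D. \<epsilon> * (?e s - (1/2) ^ n * w s))"
        by (simp only: sum_distrib_left sum_subtractf[symmetric])
      also have "\<dots> \<le> (\<Sum>s\<in>?D. \<Sum>i<k s. ?e (i # s) * norm (y (i # s) - y s))"
        by (intro sum_mono jump)
      also have "\<dots> \<le> (\<Sum>s\<in>?D. \<Sum>i<k s. ?e (i # s) * norm (y (i # s) - z) + ?e (i # s) * norm (y s - z))"
      proof (intro sum_mono)
        fix s i
        have "norm (y (i # s) - y s) \<le> norm (y (i # s) - z) + norm (y s - z)"
          using norm_triangle_ineq4[of "y (i # s) - z" "y s - z"] by simp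
        then show "?e (i # s) * norm (y (i # s) - y s)
            \<le> ?e (i # s) * norm (y (i # s) - z) + ?e (i # s) * norm (y s - z)"
          unfolding distrib_left[symmetric] by (intro mult_left_mono) auto
      qed
      also have "\<dots> = (\<Sum>s\<in>?D. \<Sum>i<k s. ?e (i # s) * norm (y (i # s) - z))
          + (\<Sum>s\<in>?D. (\<Sum>i<k s. ?e (i # s)) * norm (y s - z))"
        by (simp only: sum.distrib sum_distrib_right)
      also have "(\<Sum>s\<in>?D. \<Sum>i<k s. ?e (i # s) * norm (y (i # s) - z))
          = (\<Sum>t\<in>descendants k (n + 1) []. ?e t * norm (y t - z))"
        by (subst sum_descendants_add) (simp add: sum_descendants_Suc del: descendants.simps(2))
      also have "\<dots> + (\<Sum>s\<in>?D. (\<Sum>i<k s. ?e (i # s)) * norm (y s - z))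
          \<le> (\<delta> * ?e [] + K * \<kappa>) + (\<delta> * ?e [] + K * \<kappa>)"
        unfolding mass_additive[OF E(1)] using n by (intro add_mono n0) auto
      finally show ?thesis by (simp add: eE)
    qed
    have "(\<lambda>n. \<epsilon> * (measure M E - (1/2) ^ n * w [])) \<longlonglongrightarrow> \<epsilon> * (measure M E - 0 * w [])"
      by (intro tendsto_intros LIMSEQ_power_zero) auto
    then have "\<epsilon> * (measure M E - 0 * w []) \<le> 2 * \<delta> * measure M E + 2 * (K * \<kappa>)"
      by (rule LIMSEQ_le_const2) (use bound in blast)
    then show ?thesis by simp
  qed
  show ?thesis
  proof (rule field_le_epsilon)
    fix r :: real assume "r > 0"
    then have "r / (2 * (K + 1)) > 0" using K_nonneg by simp
    from main[OF this] have "\<epsilon> * measure M E \<le> 2 * \<delta> * measure M E + 2 * (K * (r / (2 * (K + 1))))" .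
    also have "2 * (K * (r / (2 * (K + 1)))) \<le> r"
      using K_nonneg \<open>r > 0\<close> by (simp add: divide_simps algebra_simps)
    finally show "\<epsilon> * measure M E \<le> 2 * \<delta> * measure M E + r" by simp
  qed
qed

lemma limit_operator_class:
  assumes "integrable M f"
  shows "limit_operator (ae_rep (ae_class M f)) = limit_operator f"
  using ae_rep_ae_class[OF assms] assms by (intro limit_operator_AE)

lemma limit_operator_bounded: "(\<lambda>A. limit_operator (ae_rep A)) \<in> bounded_operators (L1 M) sc"
proof -
  have "\<forall>A\<in>nspace (L1 M). norm (limit_operator (ae_rep A)) \<le> K * nnorm (L1 M) A"
    by (auto simp: nspace_L1 limit_operator_class nnorm_L1 norm_limit_operator_le)
  then show ?thesis
    unfolding bounded_operators_def
    by (auto simp: nspace_L1 nadd_L1 nscale_L1 limit_operator_class limit_operator_add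
        limit_operator_scale)
qed

end

section \<open>Range strongly exposing operators are locally almost of rank one\<close>

locale L1_operator = scalar_multiplication sc
  for M :: "'a measure" and sc :: "'k::{real_normed_field, euclidean_space} \<Rightarrow> 'y \<Rightarrow> 'y::banach" +
  fixes S :: "('a \<Rightarrow> 'k) set \<Rightarrow> 'y"
  assumes S: "S \<in> bounded_operators (L1 M) sc"
begin

lemma add:
  assumes "integrable M f" "integrable M g"
  shows "S (ae_class M (\<lambda>x. f x + g x)) = S (ae_class M f) + S (ae_class M g)"
  using S assms unfolding bounded_operators_def
  by (auto simp: nspace_L1 nadd_L1[symmetric])

lemma scale_class:
  assumes "integrable M f"
  shows "S (ae_class M (\<lambda>x. c * f x)) = sc c (S (ae_class M f))"
  using S assms unfolding bounded_operators_def
  by (auto simp: nspace_L1 nscale_L1[symmetric])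

lemma diff:
  assumes "integrable M f" "integrable M g"
  shows "S (ae_class M (\<lambda>x. f x - g x)) = S (ae_class M f) - S (ae_class M g)"
  using add[of "\<lambda>x. f x - g x" g] assms by simp

lemma bound_exists:
  obtains C where "\<And>A. A \<in> nspace (L1 M) \<Longrightarrow> norm (S A) \<le> C * nnorm (L1 M) A"
proof -
  have "\<exists>C. \<forall>A\<in>nspace (L1 M). norm (S A) \<le> C * nnorm (L1 M) A"
    using S by (simp add: bounded_operators_def)
  then show ?thesis using that by blast
qed

lemma norm_le_op_norm_unit: "A \<in> unit_ball (L1 M) \<Longrightarrow> norm (S A) \<le> op_norm (L1 M) S"
proof -
  obtain C where C: "\<And>A. A \<in> nspace (L1 M) \<Longrightarrow> norm (S A) \<le> C * nnorm (L1 M) A"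
    using bound_exists by blast
  have "norm (S A) \<le> \<bar>C\<bar>" if "A \<in> unit_ball (L1 M)" for A
  proof -
    have "0 \<le> nnorm (L1 M) A" by (simp add: L1_def)
    then have "C * nnorm (L1 M) A \<le> \<bar>C\<bar> * 1"
      using that by (intro mult_mono) (auto simp: unit_ball_def)
    then show ?thesis using C[of A] that by (simp add: unit_ball_def)
  qed
  then have "bdd_above ((\<lambda>A. norm (S A)) ` unit_ball (L1 M))" by (auto intro!: bdd_aboveI)
  then show "A \<in> unit_ball (L1 M) \<Longrightarrow> norm (S A) \<le> op_norm (L1 M) S"
    unfolding op_norm_def by (rule cSUP_upper[rotated])
qed

lemma norm_le:
  assumes f: "integrable M f"
  shows "norm (S (ae_class M f)) \<le> op_norm (L1 M) S * (\<integral>x. norm (f x) \<partial>M)"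
proof -
  define b where "b = (\<integral>x. norm (f x) \<partial>M)"
  have "b \<ge> 0" by (simp add: b_def)
  show ?thesis
  proof (cases "b = 0")
    case True
    obtain C where "\<And>A. A \<in> nspace (L1 M) \<Longrightarrow> norm (S A) \<le> C * nnorm (L1 M) A"
      using bound_exists by blast
    then show ?thesis using f True by (force simp: nspace_L1 nnorm_L1 b_def)
  next
    case False
    then have "b > 0" using \<open>b \<ge> 0\<close> by simp
    have "ae_class M (\<lambda>x. of_real (1 / b) * f x) \<in> unit_ball (L1 M)"
      using f \<open>b > 0\<close> by (auto simp: unit_ball_def nspace_L1 nnorm_L1 norm_mult b_def norm_divide)
    from norm_le_op_norm_unit[OF this] have "norm (S (ae_class M f)) / b \<le> op_norm (L1 M) S"
      unfolding scale_class[OF f] norm_sc using \<open>b > 0\<close> by (simp add: norm_divide)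
    then show ?thesis using \<open>b > 0\<close> by (simp add: b_def divide_le_eq)
  qed
qed

lemma L1_operator_diff:
  assumes "L1_operator M sc S'"
  shows "L1_operator M sc (\<lambda>A. S A - S' A)"
proof -
  interpret S': L1_operator M sc S' by fact
  obtain C where C: "\<And>A. A \<in> nspace (L1 M) \<Longrightarrow> norm (S A) \<le> C * nnorm (L1 M) A"
    using bound_exists by blast
  obtain C' where C': "\<And>A. A \<in> nspace (L1 M) \<Longrightarrow> norm (S' A) \<le> C' * nnorm (L1 M) A"
    using S'.bound_exists by blast
  have bd: "norm (S A - S' A) \<le> (C + C') * nnorm (L1 M) A" if "A \<in> nspace (L1 M)" for A
    using C[OF that] C'[OF that] norm_triangle_ineq4[of "S A" "S' A"] by (simp add: distrib_right)
  show ?thesis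
  proof
    show "(\<lambda>A. S A - S' A) \<in> bounded_operators (L1 M) sc"
      unfolding bounded_operators_def
    proof (intro CollectI conjI ballI allI exI[of _ "C + C'"] bd)
      fix A B :: "('a \<Rightarrow> 'k) set" assume "A \<in> nspace (L1 M)" "B \<in> nspace (L1 M)"
      then show "S (nadd (L1 M) A B) - S' (nadd (L1 M) A B) = S A - S' A + (S B - S' B)"
        using S S'.S by (simp add: bounded_operators_def)
    next
      fix c and A :: "('a \<Rightarrow> 'k) set" assume "A \<in> nspace (L1 M)"
      then show "S (nscale (L1 M) c A) - S' (nscale (L1 M) c A) = sc c (S A - S' A)"
        using S S'.S by (simp add: bounded_operators_def scale_right_diff_distrib)
    qed
  qed
qed

end

text \<open>
  Strict convexity of the norm at \<open>1\<close>.
\<close>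

lemma convex_combination_eq_one:
  fixes \<theta> \<theta>' :: "'k::{real_normed_field, real_inner}"
  assumes "norm \<theta> = 1" "norm \<theta>' = 1" "0 < b" "0 \<le> b'" "b + b' = 1" "b *\<^sub>R \<theta> + b' *\<^sub>R \<theta>' = 1"
  shows "\<theta> = 1"
proof -
  have le: "inner \<theta> 1 \<le> 1" "inner \<theta>' 1 \<le> 1"
    using norm_cauchy_schwarz[of \<theta> 1] norm_cauchy_schwarz[of \<theta>' 1] assms by auto
  have one: "inner (1::'k) 1 = 1" by (simp add: power2_norm_eq_inner[symmetric])
  have "b * inner \<theta> 1 + b' * inner \<theta>' 1 = inner (b *\<^sub>R \<theta> + b' *\<^sub>R \<theta>') 1" by (simp add: inner_add_left)
  also have "\<dots> = 1" using assms one by simp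
  finally have sum: "b * inner \<theta> 1 + b' * inner \<theta>' 1 = 1" .
  have "b' * inner \<theta>' 1 \<le> b' * 1" using le assms by (intro mult_left_mono)
  then have "b * 1 \<le> b * inner \<theta> 1" using sum assms(5) by linarith
  then have "inner \<theta> 1 = 1" using le \<open>0 < b\<close> by simp
  moreover have "inner \<theta> \<theta> = 1" using assms by (simp add: power2_norm_eq_inner[symmetric])
  ultimately have "inner (\<theta> - 1) (\<theta> - 1) = 0"
    using one by (simp add: inner_diff_left inner_diff_right inner_commute)
  then show ?thesis by simp
qed

text \<open>
  The triangle inequality cannot be strict when the maximising vector \<open>f\<close> is split into \<open>1\<^sub>B f\<close> and
  the rest, so both parts attain the norm after normalisation.  The constant sequence at such a part
  is maximising, and the exposing property puts its image into \<open>\<theta> S f\<close> with \<open>|\<theta>| = 1\<close>.  The two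
  images add up to \<open>S f\<close>, which forces both factors \<open>\<theta>\<close> to be \<open>1\<close>.
\<close>

lemma RSE_rank_one_on_support:
  fixes sc :: "'k::{real_normed_field, euclidean_space} \<Rightarrow> 'y \<Rightarrow> 'y::banach"
  assumes "banach_over sc" and RSE: "S \<in> RSE (L1 M) sc" and pos: "0 < op_norm (L1 M) S"
  obtains f where "integrable M f" "(\<integral>x. norm (f x) \<partial>M) = 1"
    "norm (S (ae_class M f)) = op_norm (L1 M) S"
    "\<And>B. B \<in> sets M \<Longrightarrow> S (ae_class M (\<lambda>x. indicator B x *\<^sub>R f x))
      = (\<integral>x. norm (indicator B x *\<^sub>R f x) \<partial>M) *\<^sub>R S (ae_class M f)"
proof -
  interpret L1_operator M sc S
    using assms by (simp add: L1_operator_def L1_operator_axioms_def scalar_multiplication_def RSE_def)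
  define \<nu> where "\<nu> = op_norm (L1 M) S"
  obtain A0 where A0: "A0 \<in> unit_sphere (L1 M)"
    and exposed: "\<And>x. range x \<subseteq> unit_ball (L1 M) \<Longrightarrow> (\<lambda>n. norm (S (x n))) \<longlonglongrightarrow> \<nu> \<Longrightarrow>
       (\<exists>\<sigma> \<theta>. strict_mono (\<sigma> :: nat \<Rightarrow> nat) \<and> norm \<theta> = 1 \<and> (\<lambda>n. S (x (\<sigma> n))) \<longlonglongrightarrow> sc \<theta> (S A0))"
    using RSE unfolding RSE_def \<nu>_def by blast
  obtain f where f: "integrable M f" "A0 = ae_class M f"
    using A0 by (auto simp: unit_sphere_def nspace_L1)
  have norm_f: "(\<integral>x. norm (f x) \<partial>M) = 1"
    using A0 f by (simp add: unit_sphere_def nnorm_L1)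
  define z where "z = S (ae_class M f)"
  \<comment> \<open>the norm is attained: apply the exposing property to a maximising sequence\<close>
  have norm_z: "norm z = \<nu>"
  proof -
    have "\<exists>A\<in>unit_ball (L1 M). \<nu> - 1 / real (Suc n) < norm (S A)" for n
    proof (rule ccontr)
      assume "\<not> ?thesis"
      then have "norm (S A) \<le> \<nu> - 1 / real (Suc n)" if "A \<in> unit_ball (L1 M)" for A
        using that by (auto simp: not_less)
      moreover have "A0 \<in> unit_ball (L1 M)" using A0 by (simp add: unit_ball_def unit_sphere_def)
      ultimately have "op_norm (L1 M) S \<le> \<nu> - 1 / real (Suc n)"
        unfolding op_norm_def by (intro cSUP_least) auto
      then show False by (simp add: \<nu>_def)
    qed
    then obtain x where x: "\<And>n. x n \<in> unit_ball (L1 M)" "\<And>n. \<nu> - 1 / real (Suc n) < norm (S (x n))"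
      by metis
    have lim: "(\<lambda>n. norm (S (x n))) \<longlonglongrightarrow> \<nu>"
    proof (rule tendsto_sandwich)
      show "(\<lambda>n. \<nu> - 1 / real (Suc n)) \<longlonglongrightarrow> \<nu>"
        using tendsto_diff[OF tendsto_const LIMSEQ_inverse_real_of_nat, of \<nu>]
        by (simp add: inverse_eq_divide)
      show "(\<lambda>n. \<nu>) \<longlonglongrightarrow> \<nu>" by simp
    qed (use x norm_le_op_norm_unit in \<open>auto simp: \<nu>_def intro!: always_eventually less_imp_le\<close>)
    then obtain \<sigma> \<theta> where \<sigma>: "strict_mono (\<sigma> :: nat \<Rightarrow> nat)" "norm \<theta> = 1"
      "(\<lambda>n. S (x (\<sigma> n))) \<longlonglongrightarrow> sc \<theta> (S A0)"
      using exposed[of x] x by blast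
    have "(\<lambda>n. norm (S (x (\<sigma> n)))) \<longlonglongrightarrow> norm (sc \<theta> (S A0))" using \<sigma>(3) by (rule tendsto_norm)
    moreover have "(\<lambda>n. norm (S (x (\<sigma> n)))) \<longlonglongrightarrow> \<nu>"
      using LIMSEQ_subseq_LIMSEQ[OF lim \<sigma>(1)] by (simp add: o_def)
    ultimately show ?thesis using \<sigma>(2) f(2) by (simp add: LIMSEQ_unique norm_sc z_def)
  qed
  have peak: "\<exists>\<theta>. norm \<theta> = 1 \<and> S (ae_class M g) = b *\<^sub>R sc \<theta> z"
    if g: "integrable M g" "(\<integral>x. norm (g x) \<partial>M) = b" "norm (S (ae_class M g)) = \<nu> * b" and "b > 0" for g b
  proof -
    define A where "A = ae_class M (\<lambda>x. of_real (1 / b) * g x)"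
    have SA: "S A = (1 / b) *\<^sub>R S (ae_class M g)"
      unfolding A_def scale_class[OF g(1)] sc_of_real ..
    have "A \<in> unit_ball (L1 M)"
      using g \<open>b > 0\<close> by (auto simp: A_def unit_ball_def nspace_L1 nnorm_L1 norm_mult norm_divide)
    moreover have "(\<lambda>n::nat. norm (S A)) \<longlonglongrightarrow> \<nu>"
      using g \<open>b > 0\<close> by (simp add: SA)
    ultimately obtain \<theta> where "norm \<theta> = 1" "(\<lambda>n::nat. S A) \<longlonglongrightarrow> sc \<theta> (S A0)"
      using exposed[of "\<lambda>_. A"] by auto
    then have "S A = sc \<theta> z" by (simp add: LIMSEQ_const_iff f z_def)
    then have "S (ae_class M g) = b *\<^sub>R sc \<theta> z" using SA \<open>b > 0\<close> by (metis divide_self_if less_irrefl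
          scaleR_one scaleR_scaleR times_divide_eq_right mult.right_neutral)
    then show ?thesis using \<open>norm \<theta> = 1\<close> by blast
  qed
  have "S (ae_class M (\<lambda>x. indicator B x *\<^sub>R f x)) = (\<integral>x. norm (indicator B x *\<^sub>R f x) \<partial>M) *\<^sub>R z"
    if B: "B \<in> sets M" for B
  proof -
    let ?f1 = "\<lambda>x. indicator B x *\<^sub>R f x" and ?f2 = "\<lambda>x. indicator (space M - B) x *\<^sub>R f x"
    define b1 where "b1 = (\<integral>x. norm (?f1 x) \<partial>M)"
    define b2 where "b2 = (\<integral>x. norm (?f2 x) \<partial>M)"
    have int: "integrable M ?f1" "integrable M ?f2"
      using B f(1) by (auto intro!: integrable_mult_indicator)
    have "b1 + b2 = (\<integral>x. norm (?f1 x) + norm (?f2 x) \<partial>M)"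
      unfolding b1_def b2_def using int
      by (intro Bochner_Integration.integral_add[symmetric] integrable_norm)
    also have "\<dots> = (\<integral>x. norm (f x) \<partial>M)"
      by (intro Bochner_Integration.integral_cong) (auto simp: indicator_def)
    finally have b: "b1 + b2 = 1" using norm_f by simp
    have b_nonneg: "b1 \<ge> 0" "b2 \<ge> 0" by (simp_all add: b1_def b2_def)
    have "ae_class M (\<lambda>x. ?f1 x + ?f2 x) = ae_class M f"
      using int f(1) by (intro ae_class_eqI) (auto simp: indicator_def)
    then have sum: "S (ae_class M ?f1) + S (ae_class M ?f2) = z"
      using add[OF int] by (simp add: z_def)
    have le: "norm (S (ae_class M ?f1)) \<le> \<nu> * b1" "norm (S (ae_class M ?f2)) \<le> \<nu> * b2"
      using norm_le[OF int(1)] norm_le[OF int(2)] by (simp_all add: \<nu>_def b1_def b2_def)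
    have "\<nu> * b1 + \<nu> * b2 \<le> norm (S (ae_class M ?f1)) + norm (S (ae_class M ?f2))"
      using norm_triangle_ineq[of "S (ae_class M ?f1)" "S (ae_class M ?f2)"] b
      unfolding sum norm_z distrib_left[symmetric] by simp
    then have eq: "norm (S (ae_class M ?f1)) = \<nu> * b1" "norm (S (ae_class M ?f2)) = \<nu> * b2"
      using le by auto
    consider "b1 = 0" | "b2 = 0" | "b1 > 0" "b2 > 0" using b_nonneg by fastforce
    then have "S (ae_class M ?f1) = b1 *\<^sub>R z"
    proof cases
      case 1
      then show ?thesis using eq by simp
    next
      case 2
      then show ?thesis using eq sum b by simp
    next
      case 3
      obtain \<theta>1 where \<theta>1: "norm \<theta>1 = 1" "S (ae_class M ?f1) = b1 *\<^sub>R sc \<theta>1 z"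
        using peak[OF int(1) b1_def[symmetric] eq(1) 3(1)] by blast
      obtain \<theta>2 where \<theta>2: "norm \<theta>2 = 1" "S (ae_class M ?f2) = b2 *\<^sub>R sc \<theta>2 z"
        using peak[OF int(2) b2_def[symmetric] eq(2) 3(2)] by blast
      have "sc (b1 *\<^sub>R \<theta>1 + b2 *\<^sub>R \<theta>2) z = sc 1 z"
        using sum unfolding \<theta>1(2) \<theta>2(2)
        by (simp add: scaleR_conv_of_real scale_left_distrib sc_of_real scale_scale[symmetric] del: scale_scale)
      moreover have "z \<noteq> 0" using norm_z pos by (auto simp: \<nu>_def)
      ultimately have "b1 *\<^sub>R \<theta>1 + b2 *\<^sub>R \<theta>2 = 1" using scale_cancel_right by blast
      then have "\<theta>1 = 1" by (rule convex_combination_eq_one[OF \<theta>1(1) \<theta>2(1) 3(1) b_nonneg(2) b])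
      then show ?thesis using \<theta>1(2) by simp
    qed
    then show ?thesis by (simp add: b1_def)
  qed
  then show ?thesis using that[OF f(1) norm_f] norm_z by (simp add: z_def \<nu>_def)
qed

text \<open>
  Countably many of the open sets \<open>{x. |x - c| < \<kappa> |c|}\<close> cover all non-zero scalars.  The relative
  precision \<open>\<kappa> |c|\<close> is what makes \<open>c = 0\<close> drop out.
\<close>

lemma nearly_constant_piece:
  fixes f :: "'a \<Rightarrow> 'k::{real_normed_field, euclidean_space}"
  assumes f: "f \<in> borel_measurable M" and nz: "\<not> (AE x in M. f x = 0)" and "\<kappa> > 0"
  obtains c where "c \<noteq> 0" "emeasure M {x\<in>space M. norm (f x - c) < \<kappa> * norm c} > 0"
proof -
  obtain D :: "'k set" where D: "countable D" "\<And>U. open U \<Longrightarrow> U \<noteq> {} \<Longrightarrow> \<exists>d\<in>D. d \<in> U"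
    using countable_dense_exists by blast
  have "\<exists>c\<in>D. c \<noteq> 0 \<and> emeasure M {x\<in>space M. norm (f x - c) < \<kappa> * norm c} > 0"
  proof (rule ccontr)
    assume none: "\<not> ?thesis"
    have "AE x in M. \<forall>c\<in>D. c \<noteq> 0 \<longrightarrow> \<not> norm (f x - c) < \<kappa> * norm c"
      unfolding AE_ball_countable[OF D(1)]
    proof
      fix c assume c: "c \<in> D"
      show "AE x in M. c \<noteq> 0 \<longrightarrow> \<not> norm (f x - c) < \<kappa> * norm c"
      proof (cases "c = 0")
        case False
        then have "emeasure M {x\<in>space M. norm (f x - c) < \<kappa> * norm c} = 0"
          using none c by auto
        then show ?thesis
          using f by (intro AE_I[where N = "{x\<in>space M. norm (f x - c) < \<kappa> * norm c}"]) auto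
      qed simp
    qed
    then have "AE x in M. f x = 0"
    proof eventually_elim
      case (elim x)
      show ?case
      proof (rule ccontr)
        assume "f x \<noteq> 0"
        have "open {c. norm (f x - c) < \<kappa> * norm c}"
          by (intro open_Collect_less continuous_intros)
        moreover have "f x \<in> {c. norm (f x - c) < \<kappa> * norm c}" using \<open>f x \<noteq> 0\<close> \<open>\<kappa> > 0\<close> by simp
        ultimately obtain c where c: "c \<in> D" "norm (f x - c) < \<kappa> * norm c"
          using D(2) by blast
        then have "c \<noteq> 0" by auto
        then show False using elim c by blast
      qed
    qed
    then show False using nz by simp
  qed
  then show ?thesis using that by blast
qed

text \<open>
  Replacing \<open>f\<close> by a constant \<open>c\<close> with relative error \<open>\<kappa>\<close> in the rank one formula costs \<open>\<nu> \<kappa>\<close> on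
  each side, where \<open>\<nu>\<close> is the norm of \<open>S\<close>.  The hypothesis that \<open>S\<close> has norm at most \<open>\<rho> < \<nu>\<close> on
  functions vanishing on \<open>E\<close> forces \<open>f\<close> to vanish outside \<open>E\<close>, so that the piece may be chosen
  inside \<open>E\<close>.
\<close>

lemma RSE_nearly_rank_one_piece:
  fixes sc :: "'k::{real_normed_field, euclidean_space} \<Rightarrow> 'y \<Rightarrow> 'y::banach"
  assumes "finite_measure M" "banach_over sc" "S \<in> RSE (L1 M) sc" "0 < op_norm (L1 M) S" "\<delta> > 0"
    and vanish: "\<And>f. integrable M f \<Longrightarrow> (\<And>x. x \<in> E \<Longrightarrow> f x = 0) \<Longrightarrow>
      norm (S (ae_class M f)) \<le> \<rho> * (\<integral>x. norm (f x) \<partial>M)"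
    and \<rho>: "\<rho> < op_norm (L1 M) S" and E: "E \<in> sets M"
  obtains F z where "F \<in> sets M" "F \<subseteq> E" "measure M F > 0"
    "\<And>B. B \<in> sets M \<Longrightarrow> B \<subseteq> F \<Longrightarrow>
      norm (S (ae_class M (indicator B)) - measure M B *\<^sub>R z) \<le> \<delta> * measure M B"
proof -
  interpret finite_measure M by fact
  interpret L1_operator M sc S
    using assms by (simp add: L1_operator_def L1_operator_axioms_def scalar_multiplication_def RSE_def)
  define \<nu> where "\<nu> = op_norm (L1 M) S"
  have "\<nu> > 0" using assms by (simp add: \<nu>_def)
  obtain f where f: "integrable M f" "(\<integral>x. norm (f x) \<partial>M) = 1" "norm (S (ae_class M f)) = \<nu>"
    and rank_one: "\<And>B. B \<in> sets M \<Longrightarrow> S (ae_class M (\<lambda>x. indicator B x *\<^sub>R f x))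
      = (\<integral>x. norm (indicator B x *\<^sub>R f x) \<partial>M) *\<^sub>R S (ae_class M f)"
    using RSE_rank_one_on_support[OF assms(2-4)] unfolding \<nu>_def by blast
  have [measurable]: "f \<in> borel_measurable M" "E \<in> sets M" using f E by auto
  define \<kappa> where "\<kappa> = min 1 (\<delta> / (2 * \<nu>))"
  have \<kappa>: "\<kappa> > 0" "\<kappa> \<le> 1" "2 * \<nu> * \<kappa> \<le> \<delta>"
  proof -
    have "2 * \<nu> * \<kappa> \<le> 2 * \<nu> * (\<delta> / (2 * \<nu>))"
      using \<open>\<nu> > 0\<close> by (intro mult_left_mono) (auto simp: \<kappa>_def)
    then show "2 * \<nu> * \<kappa> \<le> \<delta>" using \<open>\<nu> > 0\<close> by simp
  qed (use \<open>\<nu> > 0\<close> \<open>\<delta> > 0\<close> in \<open>auto simp: \<kappa>_def\<close>)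
  have "\<not> (AE x in M. f x = 0)"
  proof
    assume "AE x in M. f x = 0"
    then have "(\<integral>x. norm (f x) \<partial>M) = 0" by (intro integral_eq_zero_AE) auto
    then show False using f by simp
  qed
  then obtain c where c: "c \<noteq> 0" "emeasure M {x\<in>space M. norm (f x - c) < \<kappa> * norm c} > 0"
    by (rule nearly_constant_piece[OF \<open>f \<in> borel_measurable M\<close> _ \<kappa>(1)])
  \<comment> \<open>since \<open>\<kappa> \<le> 1\<close>, \<open>f\<close> does not vanish on this set\<close>
  define F1 where "F1 = {x\<in>space M. norm (f x - c) < \<kappa> * norm c}"
  have F1 [measurable]: "F1 \<in> sets M" by (simp add: F1_def)
  have "AE x in M. x \<in> space M - E \<longrightarrow> f x = 0"
  proof -
    let ?g = "\<lambda>x. indicator (space M - E) x *\<^sub>R f x"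
    have int: "integrable M ?g" using f by (intro integrable_mult_indicator) auto
    have "norm (S (ae_class M ?g)) \<le> \<rho> * (\<integral>x. norm (?g x) \<partial>M)"
      using int by (intro vanish) auto
    then have "\<nu> * (\<integral>x. norm (?g x) \<partial>M) \<le> \<rho> * (\<integral>x. norm (?g x) \<partial>M)"
      using rank_one[of "space M - E"] f by (simp add: mult.commute)
    then have "(\<integral>x. norm (?g x) \<partial>M) \<le> 0"
      using \<rho> unfolding \<nu>_def[symmetric] by (auto simp: mult_le_cancel_right)
    moreover have "0 \<le> (\<integral>x. norm (?g x) \<partial>M)"
      by (intro Bochner_Integration.integral_nonneg) simp
    ultimately have "(\<integral>x. norm (?g x) \<partial>M) = 0" by (rule antisym)
    then have "AE x in M. norm (?g x) = 0"
      using integrable_norm[OF int] by (subst (asm) integral_nonneg_eq_0_iff_AE) auto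
    then show ?thesis by eventually_elim (auto simp: indicator_def)
  qed
  then have "AE x in M. x \<in> F1 \<longrightarrow> x \<in> F1 \<inter> E"
  proof eventually_elim
    case (elim x)
    have "\<kappa> * norm c \<le> norm c" using \<kappa> by (intro mult_left_le_one_le) auto
    then show ?case using elim by (auto simp: F1_def)
  qed
  then have "measure M F1 \<le> measure M (F1 \<inter> E)"
    by (intro finite_measure_mono_AE) auto
  moreover have "measure M F1 > 0"
    using c(2) by (simp add: F1_def emeasure_eq_measure)
  ultimately have pos: "measure M (F1 \<inter> E) > 0" by simp
  define z where "z = sc (of_real (norm c) / c) (S (ae_class M f))"
  show ?thesis
  proof (rule that[of "F1 \<inter> E" z])
    fix B assume B: "B \<in> sets M" "B \<subseteq> F1 \<inter> E"
    have [measurable]: "B \<in> sets M" by fact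
    let ?m = "measure M B" and ?b = "\<integral>x. norm (indicator B x *\<^sub>R f x) \<partial>M"
    have int_ind: "integrable M (indicator B :: 'a \<Rightarrow> 'k)"
      and int_ind_real: "integrable M (indicator B :: 'a \<Rightarrow> real)"
      by (auto intro: integrable_indicator_scalar)
    have int_f: "integrable M (\<lambda>x. indicator B x *\<^sub>R f x)"
      using f by (intro integrable_mult_indicator) auto
    have near: "norm (c - f x) \<le> \<kappa> * norm c" if "x \<in> B" for x
      using B that by (auto simp: F1_def norm_minus_commute)
    have "norm (sc c (S (ae_class M (indicator B))) - ?b *\<^sub>R S (ae_class M f))
        = norm (S (ae_class M (\<lambda>x. c * indicator B x - indicator B x *\<^sub>R f x)))"
      using int_ind int_f B by (simp add: diff scale_class rank_one)
    also have "\<dots> \<le> \<nu> * (\<integral>x. norm (c * indicator B x - indicator B x *\<^sub>R f x) \<partial>M)"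
      unfolding \<nu>_def using int_ind int_f by (intro norm_le) auto
    also have "\<dots> \<le> \<nu> * (\<integral>x. \<kappa> * norm c * indicator B x \<partial>M)"
    proof (intro mult_left_mono integral_mono)
      show "integrable M (\<lambda>x. norm (c * indicator B x - indicator B x *\<^sub>R f x))"
        using int_ind int_f
        by (intro integrable_norm Bochner_Integration.integrable_diff integrable_mult_right)
      show "integrable M (\<lambda>x. \<kappa> * norm c * indicator B x)"
        using int_ind_real by (intro integrable_mult_right)
      show "norm (c * indicator B x - indicator B x *\<^sub>R f x) \<le> \<kappa> * norm c * indicator B x" for x
        using near[of x] by (auto simp: indicator_def)
    qed (use \<open>\<nu> > 0\<close> in simp)
    finally have 1: "norm (sc c (S (ae_class M (indicator B))) - ?b *\<^sub>R S (ae_class M f)) \<le> \<nu> * (\<kappa> * norm c * ?m)"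
      by simp
    note int_norm = integrable_norm[OF int_f] integrable_mult_right[OF int_ind_real, of "norm c"]
    have "\<bar>?b - norm c * ?m\<bar> = \<bar>\<integral>x. norm (indicator B x *\<^sub>R f x) - norm c * indicator B x \<partial>M\<bar>"
      using Bochner_Integration.integral_diff[OF int_norm] by simp
    also have "\<dots> \<le> (\<integral>x. \<bar>norm (indicator B x *\<^sub>R f x) - norm c * indicator B x\<bar> \<partial>M)"
      by (rule integral_abs_bound)
    also have "\<dots> \<le> (\<integral>x. \<kappa> * norm c * indicator B x \<partial>M)"
    proof (rule integral_mono)
      show "\<bar>norm (indicator B x *\<^sub>R f x) - norm c * indicator B x\<bar> \<le> \<kappa> * norm c * indicator B x" for x
        using near[of x] norm_triangle_ineq3[of "f x" c] by (auto simp: indicator_def norm_minus_commute)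
      show "integrable M (\<lambda>x. \<bar>norm (indicator B x *\<^sub>R f x) - norm c * indicator B x\<bar>)"
        by (intro integrable_abs Bochner_Integration.integrable_diff int_norm)
      show "integrable M (\<lambda>x. \<kappa> * norm c * indicator B x)"
        using int_ind_real by (intro integrable_mult_right)
    qed
    finally have "\<bar>?b - norm c * ?m\<bar> \<le> \<kappa> * norm c * ?m" by simp
    then have 2: "norm (?b *\<^sub>R S (ae_class M f) - (norm c * ?m) *\<^sub>R S (ae_class M f)) \<le> \<kappa> * norm c * ?m * \<nu>"
      using \<open>\<nu> > 0\<close> f(3) by (simp add: scaleR_diff_left[symmetric] mult_right_mono)
    have "sc c (measure M B *\<^sub>R z) = (norm c * ?m) *\<^sub>R S (ae_class M f)"
    proof -
      have "sc c (measure M B *\<^sub>R z) = sc (c * of_real ?m * (of_real (norm c) / c)) (S (ae_class M f))"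
        unfolding z_def sc_of_real[symmetric] by simp
      also have "c * of_real ?m * (of_real (norm c) / c) = of_real (norm c * ?m)"
        using c(1) by (simp add: field_simps)
      finally show ?thesis by (simp add: sc_of_real del: of_real_mult)
    qed
    then have "norm c * norm (S (ae_class M (indicator B)) - measure M B *\<^sub>R z)
        = norm (sc c (S (ae_class M (indicator B))) - (norm c * ?m) *\<^sub>R S (ae_class M f))"
      by (simp add: norm_sc[symmetric] scale_right_diff_distrib)
    also have "\<dots> \<le> \<nu> * (\<kappa> * norm c * ?m) + \<kappa> * norm c * ?m * \<nu>"
      using norm_triangle_le[OF add_mono[OF 1 2]] by simp
    also have "\<dots> = norm c * (2 * \<nu> * \<kappa> * ?m)" by (simp add: algebra_simps)
    finally have "norm (S (ae_class M (indicator B)) - measure M B *\<^sub>R z) \<le> 2 * \<nu> * \<kappa> * ?m"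
      using c(1) by simp
    also have "\<dots> \<le> \<delta> * ?m" using \<kappa> by (intro mult_right_mono) auto
    finally show "norm (S (ae_class M (indicator B)) - measure M B *\<^sub>R z) \<le> \<delta> * measure M B" .
  qed (use pos in auto)
qed

section \<open>Density of range strongly exposing operators\<close>

text \<open>
  The tolerance \<open>\<epsilon>/8\<close> is used twice: for the distance of \<open>S\<close> to \<open>T\<close> and for the deviation of \<open>S\<close> from
  rank one.  Together they leave \<open>T\<close> within \<open>\<epsilon>/4 < \<epsilon>/2\<close> of rank one, too close for an oscillating
  tree.
\<close>

theorem RNP_of_dense_RSE:
  fixes M :: "'a measure" and sc :: "'k::{real_normed_field, euclidean_space} \<Rightarrow> 'y \<Rightarrow> 'y::banach"
  assumes M: "finite_measure M" "\<not> purely_atomic M" and sc: "banach_over sc"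
    and dense: "op_dense (L1 M) (RSE (L1 M) sc) (bounded_operators (L1 M) sc)"
  shows "radon_nikodym_property TYPE('w) TYPE('y)"
  unfolding radon_nikodym_property_def
proof (intro allI impI, rule ccontr)
  fix N :: "'w measure" and G :: "'w set \<Rightarrow> 'y"
  assume N: "finite_measure N" "vector_measure N G" "measure_continuous N G" "bounded_variation N G"
    and no: "\<not> (\<exists>g. bochner_integrable N g \<and>
      (\<forall>E\<in>sets N. has_bochner N (\<lambda>x. indicator E x *\<^sub>R g x) (G E)))"
  interpret M: finite_measure M by fact
  interpret G: continuous_vector_measure N G
    using N by (simp add: continuous_vector_measure_def continuous_vector_measure_axioms_def)
  obtain E where E: "E \<in> sets M" "emeasure M E > 0" "\<And>A. A \<subseteq> E \<Longrightarrow> \<not> is_atom M A"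
    using M(2) unfolding purely_atomic_def by blast
  have mE: "measure M E > 0" using E(2) by (simp add: M.emeasure_eq_measure)
  obtain A K \<epsilon> where A: "A \<in> sets N" "measure N A > 0" "K > 0" "\<epsilon> > 0"
    "\<And>C. C \<in> sets N \<Longrightarrow> C \<subseteq> A \<Longrightarrow> norm (G C) \<le> K * measure N C"
    "\<And>B y. B \<in> sets N \<Longrightarrow> B \<subseteq> A \<Longrightarrow> measure N B > 0 \<Longrightarrow>
      \<exists>C\<in>sets N. C \<subseteq> B \<and> norm (G C - measure N C *\<^sub>R y) > \<epsilon> * measure N C"
    "norm (G A) > \<epsilon> * measure N A"
    using G.oscillating_set_of_no_density[OF N(4) no] by metis
  obtain k w and y :: "nat list \<Rightarrow> 'y" where
    tree: "oscillating_tree k w y K \<epsilon>" and root: "w [] = measure M E" "norm (y []) > \<epsilon>"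
  proof (rule G.oscillating_tree_exists[OF A(1,2,4) mE _ A(3) _ A(7)])
    fix k w and y :: "nat list \<Rightarrow> 'y"
    assume "oscillating_tree k w y K \<epsilon>" "w [] = measure M E" "norm (y []) > \<epsilon>"
    then show thesis by (rule that)
  qed (rule A(5,6); assumption)+
  interpret oscillating_tree k w y K \<epsilon> by (rule tree)
  obtain Q where Q: "Q [] = E" "\<And>s. Q s \<in> sets M" "\<And>s. measure M (Q s) = w s"
    "\<And>s. disjoint_family_on (\<lambda>i. Q (i # s)) {..<k s}" "\<And>s. (\<Union>i<k s. Q (i # s)) = Q s"
  proof (rule M.atomless_tree_partition[OF E(1) _ k_pos w_nonneg _ w_additive root(1)])
    fix Q :: "nat list \<Rightarrow> 'a set"
    assume "Q [] = E" "\<And>s. Q s \<in> sets M" "\<And>s. measure M (Q s) = w s"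
      "\<And>s. disjoint_family_on (\<lambda>i. Q (i # s)) {..<k s}" "\<And>s. (\<Union>i<k s. Q (i # s)) = Q s"
    then show thesis by (rule that)
  qed (rule E(3) w_outside; assumption)+
  interpret T: tree_operator k w y K \<epsilon> M sc Q
    by unfold_locales (use Q sc in auto)
  define T where "T = (\<lambda>A. T.limit_operator (ae_rep A))"
  have T_bounded: "T \<in> bounded_operators (L1 M) sc"
    unfolding T_def by (rule T.limit_operator_bounded)
  have T_class: "T (ae_class M f) = T.limit_operator f" if "integrable M f" for f
    unfolding T_def using that by (rule T.limit_operator_class)
  have "\<epsilon> / 8 > 0" using A(4) by simp
  then obtain S where S: "S \<in> RSE (L1 M) sc" "op_norm (L1 M) (\<lambda>A. S A - T A) < \<epsilon> / 8"
    using dense T_bounded unfolding op_dense_def by blast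
  interpret S: L1_operator M sc S using S sc by (simp add: L1_operator_def L1_operator_axioms_def scalar_multiplication_def RSE_def)
  have "L1_operator M sc T" using T_bounded sc by (simp add: L1_operator_def L1_operator_axioms_def scalar_multiplication_def)
  then interpret D: L1_operator M sc "\<lambda>A. S A - T A" by (rule S.L1_operator_diff)
  have close: "norm (S (ae_class M f) - T.limit_operator f) \<le> \<epsilon> / 8 * (\<integral>x. norm (f x) \<partial>M)"
    if f: "integrable M f" for f
  proof -
    have "norm (S (ae_class M f) - T.limit_operator f)
        \<le> op_norm (L1 M) (\<lambda>A. S A - T A) * (\<integral>x. norm (f x) \<partial>M)"
      using D.norm_le[OF f] by (simp add: T_class f)
    also have "\<dots> \<le> \<epsilon> / 8 * (\<integral>x. norm (f x) \<partial>M)"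
      using S(2) by (intro mult_right_mono) auto
    finally show ?thesis .
  qed
  have int_ind: "integrable M (indicator B :: 'a \<Rightarrow> 'k)" if "B \<in> sets M" for B
    using that by (rule M.integrable_indicator_scalar)
  have norm_ind: "(\<integral>x. norm (indicator B x :: 'k) \<partial>M) = measure M B" if "B \<in> sets M" for B
  proof -
    have "(\<integral>x. norm (indicator B x :: 'k) \<partial>M) = (\<integral>x. indicator B x \<partial>M)"
      by (intro Bochner_Integration.integral_cong) (auto simp: indicator_def)
    then show ?thesis using that by (simp add: M.emeasure_eq_measure)
  qed
  \<comment> \<open>the root of the tree has norm above \<open>\<epsilon>\<close>, so \<open>T\<close> has, too; this keeps the set where \<open>S\<close> attains its
    norm inside \<open>E\<close>, off which \<open>T\<close> vanishes\<close>
  have S_large: "op_norm (L1 M) S > \<epsilon> / 8"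
  proof -
    have "measure M E * \<epsilon> < norm (T.limit_operator (indicator E))"
      using T.limit_operator_root root mE unfolding Q(1) by simp
    moreover have "norm (T.limit_operator (indicator E)) \<le>
        norm (S (ae_class M (indicator E))) + norm (S (ae_class M (indicator E)) - T.limit_operator (indicator E))"
      by (metis norm_minus_commute norm_triangle_sub)
    moreover have "norm (S (ae_class M (indicator E))) \<le> op_norm (L1 M) S * measure M E"
      using S.norm_le[OF int_ind[OF E(1)]] norm_ind[OF E(1)] by simp
    moreover have "norm (S (ae_class M (indicator E)) - T.limit_operator (indicator E)) \<le> \<epsilon> / 8 * measure M E"
      using close[OF int_ind[OF E(1)]] norm_ind[OF E(1)] by simp
    ultimately have "measure M E * \<epsilon> < measure M E * (op_norm (L1 M) S + \<epsilon> / 8)"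
      by (simp add: algebra_simps)
    then show ?thesis using mE A(4) by simp
  qed
  have "norm (S (ae_class M f)) \<le> \<epsilon> / 8 * (\<integral>x. norm (f x) \<partial>M)"
    if f: "integrable M f" "\<And>x. x \<in> E \<Longrightarrow> f x = 0" for f
    using close[OF f(1)] T.limit_operator_outside[of f] f(2) Q(1) by simp
  moreover have "0 < op_norm (L1 M) S" using S_large A(4) by simp
  ultimately obtain F z where F: "F \<in> sets M" "F \<subseteq> E" "measure M F > 0"
    and near: "\<And>B. B \<in> sets M \<Longrightarrow> B \<subseteq> F \<Longrightarrow>
      norm (S (ae_class M (indicator B)) - measure M B *\<^sub>R z) \<le> \<epsilon> / 8 * measure M B"
    using RSE_nearly_rank_one_piece[OF M(1) sc S(1) _ \<open>\<epsilon> / 8 > 0\<close> _ S_large E(1)] by metis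
  have "\<epsilon> * measure M F \<le> 2 * (\<epsilon> / 4) * measure M F"
  proof (rule T.no_rank_one_piece)
    fix B assume B: "B \<in> sets M" "B \<subseteq> F"
    have "norm (T.limit_operator (indicator B) - measure M B *\<^sub>R z)
        \<le> norm (S (ae_class M (indicator B)) - measure M B *\<^sub>R z)
          + norm (S (ae_class M (indicator B)) - T.limit_operator (indicator B))"
      using norm_triangle_ineq4[of "S (ae_class M (indicator B)) - measure M B *\<^sub>R z"
          "S (ae_class M (indicator B)) - T.limit_operator (indicator B)"] by simp
    also have "\<dots> \<le> \<epsilon> / 8 * measure M B + \<epsilon> / 8 * measure M B"
      using close[OF int_ind[OF B(1)]] norm_ind[OF B(1)] by (intro add_mono near B) simp
    finally show "norm (T.limit_operator (indicator B) - measure M B *\<^sub>R z) \<le> \<epsilon> / 4 * measure M B"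
      by simp
  qed (use F Q A in auto)
  then show False using F(3) A(4) by simp
qed

theorem theorem3p10:
  fixes M :: "'a measure"
    and scR :: "real \<Rightarrow> 'y \<Rightarrow> 'y::banach"
    and scC :: "complex \<Rightarrow> 'y \<Rightarrow> 'y"
  assumes "finite_measure M"
    and "\<not> purely_atomic M"
  shows "(banach_over scR \<longrightarrow>
            op_dense (L1 M) (RSE (L1 M) scR) (bounded_operators (L1 M) scR) \<longrightarrow>
            radon_nikodym_property TYPE('w) TYPE('y))
       \<and> (banach_over scC \<longrightarrow>
            op_dense (L1 M) (RSE (L1 M) scC) (bounded_operators (L1 M) scC) \<longrightarrow>
            radon_nikodym_property TYPE('w) TYPE('y))"
  by (intro conjI impI RNP_of_dense_RSE[OF assms])

end
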